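(* Let $n\to\infty$, and let $N=N(n)$ be an integer with $N\ge ne^{2n}$ and $p=p(n)\in(0,1]$. The following hold asymptotically almost surely as $n\to\infty$. (i) If $p\ge N^{-\frac{2}{5n}}$, then $\frac1{16}nN\le \mathrm{ex}(G(N,p),P_{n+1})\le \frac12 nN$. (ii) Let $\omega=(\log N)/(np)$. If $N^{-1}\le p\le N^{-\frac{2}{5n}}$, then \[\frac{1}{75}\frac{\omega}{\log\omega}pnN\le \mathrm{ex}(G(N,p),P_{n+1})\le 8\frac{\omega}{\log\omega}pnN.\]
   Context: $G(N,p)$ denotes the Erdős–Rényi random graph on vertex set $[N]$ in which each pair is an edge independently with probability $p$. $P_k$ denotes the path on $k$ vertices. For graphs $G,F$, $\mathrm{ex}(G,F)$ is the maximum number of edges in an $F$-free subgraph of $G$. All logarithms are natural. "Asymptotically almost surely" means with probability tending to $1$ as $n\to\infty$. *)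

theory Defs
  imports "HOL-Probability.Probability"
begin

text \<open>Graphs on vertex set [N] = {1..N} are represented by their edge sets,
  an edge being a 2-element subset of {1..N}.\<close>

definition all_pairs :: "nat \<Rightarrow> nat set set" where
  "all_pairs N = {e. e \<subseteq> {1..N} \<and> card e = 2}"

definition gnp :: "nat \<Rightarrow> real \<Rightarrow> nat set set pmf" where
  "gnp N p = map_pmf (\<lambda>f. {e \<in> all_pairs N. f e})
               (Pi_pmf (all_pairs N) False (\<lambda>_. bernoulli_pmf p))"

definition path_vertices :: "nat \<Rightarrow> nat set" where
  "path_vertices k = {0..<k}"

definition path_edges :: "nat \<Rightarrow> nat set set" where
  "path_edges k = {{i, Suc i} | i. Suc i < k}"

definition contains_copy :: "'a set set \<Rightarrow> 'b set \<Rightarrow> 'b set set \<Rightarrow> bool" where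
  "contains_copy H V F \<longleftrightarrow> (\<exists>f. inj_on f V \<and> (\<forall>e\<in>F. f ` e \<in> H))"

definition ex_graph :: "'a set set \<Rightarrow> 'b set \<Rightarrow> 'b set set \<Rightarrow> nat" where
  "ex_graph G V F = Max {card H | H. H \<subseteq> G \<and> \<not> contains_copy H V F}"

end

theory Submission
  imports Defs "HOL-Real_Asymp.Real_Asymp"
begin

text \<open>
  Upper bounds. For dense graphs this is the Erdos-Gallai theorem. For sparse ones, a graph
  without a path on \<open>n + 1\<close> vertices has a depth-first forest of height at most \<open>n\<close>, all of whose
  edges join a vertex to an ancestor; so it is contained in one of \<open>(N + 1)^N\<close> fixed sets of at
  most \<open>n N\<close> pairs, and the first moment method applies to each of them.

  Lower bounds. Cut part of the vertices into \<open>m\<close> blocks of \<open>s\<close> cells of size \<open>r\<close> with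
  \<open>2 s r + 1 \<le> n\<close>, and join each remaining vertex to one block in each of whose cells it has a
  neighbour, if there is such a block. Every component is bipartite with one side of size at most
  \<open>s r\<close>, hence contains no path on \<open>n + 1\<close> vertices. The remaining vertices succeed independently,
  so a constant proportion of them does, and each of these contributes at least \<open>s\<close> edges. In the
  dense case \<open>r = 1\<close> and \<open>s\<close> is about \<open>n/2\<close>; in the sparse case \<open>s\<close> is proportional to
  \<open>ln N / ln \<omega>\<close>.
\<close>

section \<open>Independence and random graphs\<close>

text \<open>The restrictions of a product measure to disjoint coordinate sets are independent, and
  each \<open>g i\<close> factors through its own restriction. Measurability is free, as a finite
  product of discrete spaces is discrete.\<close>

lemma indep_vars_Pi_pmf_blocks:
  fixes g :: "'i \<Rightarrow> ('a \<Rightarrow> bool) \<Rightarrow> bool"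
  assumes fin: "finite A" and S: "\<And>i. i \<in> I \<Longrightarrow> S i \<subseteq> A" and disj: "disjoint_family_on S I"
    and g: "\<And>i f. i \<in> I \<Longrightarrow> g i f = g i (restrict f (S i))"
  shows "prob_space.indep_vars (measure_pmf (Pi_pmf A dflt P)) (\<lambda>_. count_space UNIV) g I"
proof -
  have "prob_space.indep_vars (measure_pmf (Pi_pmf A dflt P))
     (\<lambda>j. PiM (S j) (\<lambda>_. count_space UNIV)) (\<lambda>j f. restrict (\<lambda>i. f i) (S j)) I"
    by (rule prob_space.indep_vars_restrict[OF prob_space_measure_pmf indep_vars_Pi_pmf[OF fin]]) (use S disj in auto)
  then have "prob_space.indep_vars (measure_pmf (Pi_pmf A dflt P))
     (\<lambda>_. count_space UNIV) (\<lambda>j. g j \<circ> (\<lambda>f. restrict (\<lambda>i. f i) (S j))) I"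
  proof (rule prob_space.indep_vars_compose[OF prob_space_measure_pmf])
    fix i assume i: "i \<in> I"
    have "finite (S i)" using S[OF i] fin by (rule finite_subset)
    then have "PiM (S i) (\<lambda>_. count_space (UNIV::bool set)) = count_space (PiE (S i) (\<lambda>_. UNIV))"
      by (intro count_space_PiM_finite) auto
    then show "g i \<in> Pi\<^sub>M (S i) (\<lambda>_. count_space UNIV) \<rightarrow>\<^sub>M count_space UNIV" by simp
  qed
  moreover have "g i \<circ> (\<lambda>f. restrict (\<lambda>i. f i) (S i)) = g i" if "i \<in> I" for i
    using g[OF that] by (simp add: fun_eq_iff flip: g[OF that])
  ultimately show ?thesis
    by (subst prob_space.indep_vars_cong[OF prob_space_measure_pmf refl _ refl]) auto
qed

lemma prob_Pi_pmf_blocks: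
  fixes g :: "'i \<Rightarrow> ('a \<Rightarrow> bool) \<Rightarrow> bool"
  assumes fin: "finite A" and I: "finite I" and S: "\<And>i. i \<in> I \<Longrightarrow> S i \<subseteq> A"
    and disj: "disjoint_family_on S I"
    and g: "\<And>i f. i \<in> I \<Longrightarrow> g i f = g i (restrict f (S i))"
  shows "measure_pmf.prob (Pi_pmf A dflt P) {f. \<forall>i\<in>I. g i f}
     = (\<Prod>i\<in>I. measure_pmf.prob (Pi_pmf A dflt P) {f. g i f})"
proof (cases "I = {}")
  case True
  then show ?thesis using measure_pmf.prob_space[of "Pi_pmf A dflt P"] by simp
next
  case False
  have "prob_space.indep_vars (measure_pmf (Pi_pmf A dflt P)) (\<lambda>_. count_space UNIV) g I"
    using fin S disj g by (rule indep_vars_Pi_pmf_blocks)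
  from prob_space.indep_varsD[OF prob_space_measure_pmf this False I, of "\<lambda>_. {True}"] False I
  have "measure_pmf.prob (Pi_pmf A dflt P) (\<Inter>i\<in>I. g i -` {True}) = (\<Prod>i\<in>I. measure_pmf.prob (Pi_pmf A dflt P) (g i -` {True}))" by simp
  moreover have "(\<Inter>i\<in>I. g i -` {True}) = {f. \<forall>i\<in>I. g i f}" by auto
  ultimately show ?thesis by (simp add: vimage_def)
qed

text \<open>Hoeffding's inequality for the sum of the indicators: its mean is at least
  (\<open>\<delta>\<close> + \<open>\<epsilon>\<close>) times \<open>card I\<close>, so the event is
  a deviation by \<open>\<epsilon>\<close> per summand.\<close>

lemma Hoeffding_count_le:
  assumes ind: "prob_space.indep_vars (measure_pmf M) (\<lambda>_. count_space UNIV) g I"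
    and I: "finite I" "I \<noteq> {}" and q: "\<And>i. i \<in> I \<Longrightarrow> measure_pmf.prob M {x. g i x} \<ge> \<delta> + \<epsilon>" and e: "\<epsilon> \<ge> 0"
  shows "measure_pmf.prob M {x. real (card {i \<in> I. g i x}) \<le> \<delta> * card I} \<le> exp (- 2 * \<epsilon>\<^sup>2 * card I)"
proof -
  define X where "X = (\<lambda>i x. of_bool (g i x) :: real)"
  have "prob_space.indep_vars (measure_pmf M) (\<lambda>_. borel) (\<lambda>i. of_bool \<circ> g i) I"
    by (rule prob_space.indep_vars_compose[OF prob_space_measure_pmf ind]) auto
  then have iX: "prob_space.indep_vars (measure_pmf M) (\<lambda>_. borel) X I" by (simp add: X_def o_def)
  interpret H: Hoeffding_ineq "measure_pmf M" I X "\<lambda>_. 0" "\<lambda>_. 1" "\<Sum>i\<in>I. measure_pmf.expectation M (X i)"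
    by unfold_locales (use I iX in \<open>auto simp: X_def\<close>)
  have EX: "measure_pmf.expectation M (X i) = measure_pmf.prob M {x. g i x}" for i
  proof -
    have "X i = indicator {x. g i x}" by (auto simp: X_def indicator_def)
    then show ?thesis by simp
  qed
  have mu: "(\<delta> + \<epsilon>) * card I \<le> (\<Sum>i\<in>I. measure_pmf.expectation M (X i))"
    using sum_bounded_below[of I "\<delta> + \<epsilon>" "\<lambda>i. measure_pmf.expectation M (X i)"] q
        by (simp add: EX mult.commute)
  have cI: "card I > 0" using I by (simp add: card_gt_0_iff)
  have sX: "(\<Sum>i\<in>I. X i x) = card {i\<in>I. g i x}" for x
    using I by (simp add: X_def sum.If_cases Int_def of_bool_def)
  have "measure_pmf.prob M {x. real (card {i \<in> I. g i x}) \<le> \<delta> * card I}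
      \<le> measure_pmf.prob M {x \<in> space (measure_pmf M). (\<Sum>i\<in>I. X i x) \<le> (\<Sum>i\<in>I. measure_pmf.expectation M (X i)) - \<epsilon> * card I}"
    using mu by (intro measure_pmf.finite_measure_mono) (auto simp: sX algebra_simps)
  also have "\<dots> \<le> exp (-2 * (\<epsilon> * card I)\<^sup>2 / (\<Sum>i\<in>I. (1 - 0)\<^sup>2))"
    using e cI by (intro H.Hoeffding_ineq_le) auto
  also have "\<dots> = exp (- 2 * \<epsilon>\<^sup>2 * card I)"
    using cI by (simp add: power2_eq_square)
  finally show ?thesis .
qed

section \<open>Edge events in \<open>gnp\<close>\<close>

lemma finite_all_pairs [simp]: "finite (all_pairs N)"
  unfolding all_pairs_def by (rule finite_subset[of _ "Pow {1..N}"]) auto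

lemma prob_gnp:
  "measure_pmf.prob (gnp N p) S =
   measure_pmf.prob (Pi_pmf (all_pairs N) False (\<lambda>_. bernoulli_pmf p)) {f. {e \<in> all_pairs N. f e} \<in> S}"
  by (simp add: gnp_def vimage_def)

lemma set_pmf_gnp: "G \<in> set_pmf (gnp N p) \<Longrightarrow> G \<subseteq> all_pairs N"
  by (auto simp: gnp_def)

text \<open>Both values of \<open>b\<close> are needed: all edges present for the first moment
  bound, all edges absent for a cell that a vertex misses.\<close>

lemma prob_Pi_bernoulli_all:
  assumes "finite A" "T \<subseteq> A" "0 \<le> p" "p \<le> 1"
  shows "measure_pmf.prob (Pi_pmf A dflt (\<lambda>_. bernoulli_pmf p)) {f. \<forall>e\<in>T. f e = b}
     = (if b then p else 1 - p) ^ card T"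
proof -
  have "{f. \<forall>e\<in>T. f e = b} = Pi A (\<lambda>e. if e \<in> T then {b} else UNIV)"
    using assms by (auto simp: Pi_def split: if_splits)
  moreover have "finite T" using assms finite_subset by auto
  moreover have "A \<inter> T = T" using assms by auto
  ultimately show ?thesis using assms
    by (simp add: measure_Pi_pmf_Pi if_distrib[of "measure_pmf.prob _"] prod.If_cases measure_pmf_single
        measure_pmf.prob_space[simplified] cong: if_cong)
qed

lemma prob_gnp_superset_le:
  assumes "0 \<le> p" "p \<le> 1"
  shows "measure_pmf.prob (gnp N p) {G. T \<subseteq> G} \<le> p ^ card T"
proof (cases "T \<subseteq> all_pairs N")
  case True
  have "measure_pmf.prob (gnp N p) {G. T \<subseteq> G}
     = measure_pmf.prob (Pi_pmf (all_pairs N) False (\<lambda>_. bernoulli_pmf p)) {f. \<forall>e\<in>T. f e = True}"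
    unfolding prob_gnp by (rule arg_cong[where f = "measure_pmf.prob _"]) (use True in auto)
  then show ?thesis using prob_Pi_bernoulli_all[OF finite_all_pairs True assms, of False True] by simp
next
  case False
  then have "measure_pmf.prob (gnp N p) {G. T \<subseteq> G} = 0"
    unfolding measure_pmf_zero_iff using set_pmf_gnp by blast
  then show ?thesis using assms by simp
qed

text \<open>Union bound over the \<open>t\<close>-subsets of \<open>E\<close>, one of which must lie
  entirely in the random graph.\<close>

lemma prob_gnp_many_edges_le:
  fixes p :: real
  assumes "0 \<le> p" "p \<le> 1" and E: "finite E"
  shows "measure_pmf.prob (gnp N p) {G. t \<le> card (G \<inter> E)} \<le> (card E choose t) * p ^ t"
proof -
  define TT where "TT = {T. T \<subseteq> E \<and> card T = t}"
  have fT: "finite TT" unfolding TT_def using E by (auto intro: finite_subset[of _ "Pow E"])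
  have "measure_pmf.prob (gnp N p) {G. t \<le> card (G \<inter> E)}
      \<le> measure_pmf.prob (gnp N p) (\<Union>T\<in>TT. {G. T \<subseteq> G})"
  proof (intro measure_pmf.finite_measure_mono subsetI)
    fix G assume "G \<in> {G. t \<le> card (G \<inter> E)}"
    then obtain T where "T \<subseteq> G \<inter> E" "card T = t" using obtain_subset_with_card_n by blast
    then show "G \<in> (\<Union>T\<in>TT. {G. T \<subseteq> G})" by (auto simp: TT_def)
  qed simp
  also have "\<dots> \<le> (\<Sum>T\<in>TT. measure_pmf.prob (gnp N p) {G. T \<subseteq> G})"
    by (rule measure_pmf.finite_measure_subadditive_finite[OF fT]) auto
  also have "\<dots> \<le> (\<Sum>T\<in>TT. p ^ t)"
    using prob_gnp_superset_le[OF assms(1,2)] by (intro sum_mono) (auto simp: TT_def)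
  also have "\<dots> = (card E choose t) * p ^ t"
    using n_subsets[OF E, of t] by (simp add: TT_def)
  finally show ?thesis .
qed

section \<open>Paths in graphs\<close>

text \<open>Lists replace the injections of \<open>contains_copy\<close>, so that cutting, reversing
  and joining paths become list operations. Vertices are unconstrained: the empty list and all
  singletons are paths.\<close>

definition is_path :: "'a set set \<Rightarrow> 'a list \<Rightarrow> bool" where
  "is_path H xs \<longleftrightarrow> distinct xs \<and> successively (\<lambda>x y. {x, y} \<in> H) xs"

lemma is_path_rev: "is_path H (rev xs) = is_path H xs"
  by (simp add: is_path_def successively_rev insert_commute)

lemma is_path_append:
  "is_path H (xs @ ys) \<longleftrightarrow> is_path H xs \<and> is_path H ys \<and> set xs \<inter> set ys = {}
     \<and> (xs = [] \<or> ys = [] \<or> {last xs, hd ys} \<in> H)"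
  by (auto simp: is_path_def successively_append_iff)

lemma is_path_take: "is_path H xs \<Longrightarrow> is_path H (take k xs)"
  by (metis append_take_drop_id is_path_append)

lemma contains_copy_path_iff:
  "contains_copy H (path_vertices k) (path_edges k)
      \<longleftrightarrow> (\<exists>xs. length xs = k \<and> is_path H xs)"
proof
  assume "contains_copy H (path_vertices k) (path_edges k)"
  then obtain f where f: "inj_on f {0..<k}" and e: "\<forall>e\<in>path_edges k. f ` e \<in> H"
    by (auto simp: contains_copy_def path_vertices_def)
  have "f ` {i, Suc i} \<in> H" if "Suc i < k" for i
    using e that unfolding path_edges_def by blast
  then have e': "{f i, f (Suc i)} \<in> H" if "Suc i < k" for i
    using that by simp
  have "is_path H (map f [0..<k])"
    using f e' by (simp add: is_path_def distinct_map successively_conv_nth)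
  then show "\<exists>xs. length xs = k \<and> is_path H xs" by (intro exI[of _ "map f [0..<k]"]) simp
next
  assume "\<exists>xs. length xs = k \<and> is_path H xs"
  then obtain xs where "length xs = k" "is_path H xs" by blast
  then show "contains_copy H (path_vertices k) (path_edges k)"
    unfolding contains_copy_def path_vertices_def path_edges_def is_path_def
    by (intro exI[of _ "(!) xs"]) (auto simp: inj_on_def nth_eq_iff_index_eq successively_conv_nth)
qed

lemma path_free_length_le:
  assumes "\<not> contains_copy H (path_vertices (Suc n)) (path_edges (Suc n))" "is_path H xs"
  shows "length xs \<le> n"
proof (rule ccontr)
  assume "\<not> length xs \<le> n"
  then have "length (take (Suc n) xs) = Suc n" by simp
  with is_path_take[OF assms(2)] assms(1) show False unfolding contains_copy_path_iff by blast
qed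

section \<open>The extremal number as an attained maximum\<close>

lemma finite_card_subgraphs: "finite G \<Longrightarrow> finite {card H | H. H \<subseteq> G \<and> Q H}"
  by (rule finite_subset[of _ "card ` Pow G"]) auto

lemma card_le_ex_graph:
  "finite G \<Longrightarrow> H \<subseteq> G \<Longrightarrow> \<not> contains_copy H V F \<Longrightarrow> card H \<le> ex_graph G V F"
  unfolding ex_graph_def by (intro Max_ge finite_card_subgraphs) auto

lemma ex_graph_attained:
  assumes "finite G" "F \<noteq> {}"
  obtains H where "H \<subseteq> G" "\<not> contains_copy H V F" "ex_graph G V F = card H"
proof -
  have "\<not> contains_copy {} V F" using assms(2) by (auto simp: contains_copy_def)
  then have "{card H | H. H \<subseteq> G \<and> \<not> contains_copy H V F} \<noteq> {}" by blast
  then have "ex_graph G V F \<in> {card H | H. H \<subseteq> G \<and> \<not> contains_copy H V F}"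
    unfolding ex_graph_def using finite_card_subgraphs[OF assms(1)] by (intro Max_in) auto
  then show ?thesis using that by blast
qed

lemma path_edges_nonempty: "path_edges (Suc n) = {} \<longleftrightarrow> n = 0"
  by (auto simp: path_edges_def)

section \<open>Longest paths and the Erdos-Gallai theorem\<close>

lemma is_path_rotate:
  assumes "is_path H cs" "{last cs, hd cs} \<in> H" "c \<in> set cs"
  obtains us where "is_path H (us @ [c])" "set (us @ [c]) = set cs" "length (us @ [c]) = length cs"
proof -
  obtain vs ws where cs: "cs = vs @ c # ws" using assms(3) by (meson split_list)
  \<comment> \<open>The cycle is cut open just behind \<open>c\<close>; its closing edge glues the
    end of \<open>ws\<close> to the start of \<open>vs @ [c]\<close>.\<close>
  have "is_path H (ws @ vs @ [c])"
  proof (cases "ws = []")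
    case False
    with assms(1,2) show ?thesis unfolding cs is_path_append[of H ws]
      using is_path_append[of H "vs @ [c]" ws] by (auto simp: hd_append split: if_splits)
  qed (use assms cs in simp)
  then show ?thesis using that[of "ws @ vs"] cs by auto
qed

lemma longest_path_exists:
  assumes "finite V" "V \<noteq> {}"
  obtains xs where "is_path H xs" "set xs \<subseteq> V" "xs \<noteq> []"
    "\<And>ys. is_path H ys \<Longrightarrow> set ys \<subseteq> V \<Longrightarrow> length ys \<le> length xs"
proof -
  let ?P = "\<lambda>xs. is_path H xs \<and> set xs \<subseteq> V"
  obtain v where v: "v \<in> V" using assms by blast
  then have 1: "?P [v]" by (simp add: is_path_def)
  have "length ys < Suc (card V)" if "?P ys" for ys
    using that assms(1) by (metis card_mono distinct_card is_path_def less_Suc_eq_le)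
  then obtain xs where "?P xs" "\<And>ys. ?P ys \<Longrightarrow> length ys \<le> length xs"
    using ex_has_greatest_nat[of ?P, OF 1, of length "Suc (card V)"] by blast
  then show ?thesis using that[of xs] 1 by fastforce
qed

lemma edge_distinct: "card {a, b} = 2 \<longleftrightarrow> a \<noteq> b"
  by (cases "a = b") auto

text \<open>The degree count \<open>d(hd xs) + d(last xs) \<ge> length xs\<close> forces a chord pair that closes the
  longest path into a cycle through the same vertices (as in Dirac's theorem); an edge leaving a cycle would
  give a longer path.\<close>

lemma longest_path_closed:
  assumes H: "H \<subseteq> {e. e \<subseteq> V \<and> card e = 2}" and V: "finite V"
    and xs: "is_path H xs" "set xs \<subseteq> V" "xs \<noteq> []"
    and longest: "\<And>ys. is_path H ys \<Longrightarrow> set ys \<subseteq> V \<Longrightarrow> length ys \<le> length xs"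
    and deg: "length xs \<le> card {w. {hd xs, w} \<in> H} + card {w. {last xs, w} \<in> H}"
    and e: "e \<in> H" "e \<inter> set xs \<noteq> {}"
  shows "e \<subseteq> set xs"
proof (rule ccontr)
  assume "\<not> e \<subseteq> set xs"
  have "card e = 2" "e \<subseteq> V" using e H by auto
  moreover from this(1) obtain a b where "e = {a, b}" by (auto simp: card_2_iff)
  ultimately obtain c w where cw: "e = {c, w}" "c \<in> set xs" "w \<notin> set xs" "w \<in> V"
    using e(2) \<open>\<not> e \<subseteq> set xs\<close> that[of a b] that[of b a] by (auto simp: insert_commute)
  have edge: "{a, b} \<in> H \<Longrightarrow> a \<noteq> b \<and> a \<in> V \<and> b \<in> V" for a b
    using subsetD[OF H, of "{a, b}"] by (auto simp: edge_distinct)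
  \<comment> \<open>Otherwise \<open>w'\<close> would extend \<open>ys\<close> to a path longer than
    \<open>xs\<close>. This is applied to \<open>rev xs\<close>, to \<open>xs\<close>, and finally
    to the cycle cut open at \<open>c\<close>.\<close>
  have last_nb: "w' \<in> set ys" if "is_path H ys" "set ys = set xs" "length ys = length xs" "ys \<noteq> []" "{last ys, w'} \<in> H" for ys w'
  proof (rule ccontr)
    assume "w' \<notin> set ys"
    then have "is_path H (ys @ [w'])"
      using that by (auto simp: is_path_append is_path_def[of H "[w']"])
    with longest[of "ys @ [w']"] edge[OF that(5)] that(2,3) xs(2) show False by simp
  qed
  define l where "l = length xs - 1"
  have len: "length xs = Suc l" using xs(3) by (simp add: l_def)
  \<comment> \<open>Neighbours of the first vertex are indexed by their predecessors on the path,
    those of the last vertex by themselves. Both index sets lie in \<open>{..<l}\<close> while the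
    degrees add up to at least \<open>l + 1\<close>, so they share an index.\<close>
  define A where "A = {i. i < l \<and> {hd xs, xs ! Suc i} \<in> H}"
  define B where "B = {i. i < l \<and> {last xs, xs ! i} \<in> H}"
  have fin: "finite A" "finite B" by (auto simp: A_def B_def)
  have hd0: "hd xs = xs ! 0" "last xs = xs ! l" using xs(3) by (simp_all add: hd_conv_nth last_conv_nth l_def)
  have "{w. {hd xs, w} \<in> H} \<subseteq> (\<lambda>i. xs ! Suc i) ` A"
  proof
    fix x assume x: "x \<in> {w. {hd xs, w} \<in> H}"
    then have "x \<in> set (rev xs)"
      using last_nb[of "rev xs" x] xs by (auto simp: is_path_rev last_rev)
    then obtain j where j: "j < length xs" "x = xs ! j" by (auto simp: in_set_conv_nth)
    moreover have "j \<noteq> 0" using edge[of "hd xs" x] x j(2) hd0(1) by (metis mem_Collect_eq)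
    ultimately show "x \<in> (\<lambda>i. xs ! Suc i) ` A" using x len
      by (intro image_eqI[of _ _ "j - 1"]) (auto simp: A_def)
  qed
  then have cA: "card {w. {hd xs, w} \<in> H} \<le> card A" using fin(1) by (rule surj_card_le[rotated])
  have "{w. {last xs, w} \<in> H} \<subseteq> (\<lambda>i. xs ! i) ` B"
  proof
    fix x assume x: "x \<in> {w. {last xs, w} \<in> H}"
    then have "x \<in> set xs" using last_nb[of xs x] xs by auto
    then obtain j where j: "j < length xs" "x = xs ! j" by (auto simp: in_set_conv_nth)
    moreover have "j \<noteq> l" using edge[of "last xs" x] x j(2) hd0(2) by (metis mem_Collect_eq)
    ultimately show "x \<in> (\<lambda>i. xs ! i) ` B" using x len
      by (intro image_eqI[of _ _ j]) (auto simp: B_def)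
  qed
  then have cB: "card {w. {last xs, w} \<in> H} \<le> card B" using fin(2) by (rule surj_card_le[rotated])
  have "A \<inter> B \<noteq> {}"
  proof
    assume "A \<inter> B = {}"
    then have "card A + card B = card (A \<union> B)" using fin by (simp add: card_Un_disjoint)
    also have "\<dots> \<le> card {..<l}" by (rule card_mono) (auto simp: A_def B_def)
    finally show False using cA cB deg len by simp
  qed
  then obtain i where i: "i < l" "{hd xs, xs ! Suc i} \<in> H" "{last xs, xs ! i} \<in> H"
    by (auto simp: A_def B_def)
  \<comment> \<open>The cycle runs along \<open>ys\<close>, jumps by the chord from
    \<open>xs ! i\<close> to the last vertex, returns through \<open>zs\<close> backwards, and
    closes by the chord from \<open>xs ! Suc i\<close> to the first vertex.\<close>
  define ys zs where "ys = take (Suc i) xs" and "zs = drop (Suc i) xs"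
  have yz: "xs = ys @ zs" by (simp add: ys_def zs_def)
  have ne: "ys \<noteq> []" "zs \<noteq> []" using i len xs(3) by (auto simp: ys_def zs_def)
  have ends: "last ys = xs ! i" "hd zs = xs ! Suc i" "last zs = last xs"
    using i len unfolding ys_def zs_def
    by (simp_all add: hd_drop_conv_nth take_Suc_conv_app_nth)
  have "hd ys = hd xs" by (simp add: ys_def hd_take)
  note ends = this ends
  have "is_path H ys" "is_path H zs" "set ys \<inter> set zs = {}"
    using xs(1) unfolding yz is_path_append by blast+
  moreover have "{last ys, hd (rev zs)} \<in> H"
    using i(3) ends ne by (simp add: hd_rev insert_commute)
  ultimately have "is_path H (ys @ rev zs)"
    by (simp add: is_path_append is_path_rev)
  moreover have "{last (ys @ rev zs), hd (ys @ rev zs)} \<in> H"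
    using ne(1) ne(2) ends i(2) by (simp add: last_rev insert_commute)
  moreover have "c \<in> set (ys @ rev zs)" using cw(2) yz by simp
  ultimately obtain us where us: "is_path H (us @ [c])" "set (us @ [c]) = set (ys @ rev zs)"
      "length (us @ [c]) = length (ys @ rev zs)"
    by (rule is_path_rotate)
  have "{last (us @ [c]), w} \<in> H" using e(1) cw(1) by simp
  from last_nb[OF us(1) _ _ _ this] us yz cw(3) show False
    by (metis append_is_Nil_conv length_append length_rev list.discI set_append set_rev)
qed

text \<open>Induction by deleting a nonempty set \<open>S\<close> that meets at most
  (\<open>n\<close> - 1) |\<open>S\<close>| / 2 edges: either an end of a longest path, if its
  degree is small, or the whole vertex set of that path, if no edge leaves it.\<close>

theorem Erdos_Gallai_path:
  assumes "finite V" "H \<subseteq> {e. e \<subseteq> V \<and> card e = 2}" "\<And>xs. is_path H xs \<Longrightarrow> length xs \<le> n"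
  shows "2 * card H \<le> (n - 1) * card V"
  using assms
proof (induction "card V" arbitrary: V H rule: less_induct)
  case less
  have finH: "finite H" by (rule finite_subset[OF less.prems(2)]) (use less.prems(1) in auto)
  show ?case
  proof (cases "V = {}")
    case True
    then have "H = {}" using less.prems(2) by auto
    then show ?thesis by simp
  next
    case False
    have delete: ?thesis if S: "S \<subseteq> V" "S \<noteq> {}" "2 * card {e \<in> H. e \<inter> S \<noteq> {}} \<le> (n - 1) * card S" for S
    proof -
      define K where "K = {e \<in> H. e \<inter> S = {}}"
      have fS: "finite S" using S(1) less.prems(1) by (rule finite_subset)
      have cV: "card V = card S + card (V - S)"
        using fS S(1) less.prems(1) by (simp add: card_Diff_subset card_mono)
      have "card S > 0" using fS S(2) by (simp add: card_gt_0_iff)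
      have "2 * card K \<le> (n - 1) * card (V - S)"
      proof (rule less.hyps)
        show "is_path K xs \<Longrightarrow> length xs \<le> n" for xs
          by (rule less.prems(3)) (auto simp: is_path_def K_def elim: successively_mono)
      qed (use less.prems cV \<open>card S > 0\<close> in \<open>auto simp: K_def\<close>)
      moreover have "card H = card K + card {e \<in> H. e \<inter> S \<noteq> {}}"
        using finH by (subst card_Un_disjoint[symmetric]) (auto simp: K_def intro!: arg_cong[where f = card])
      ultimately show ?thesis using S(3) by (simp add: cV algebra_simps)
    qed
    obtain xs where xs: "is_path H xs" "set xs \<subseteq> V" "xs \<noteq> []"
        "\<And>ys. is_path H ys \<Longrightarrow> set ys \<subseteq> V \<Longrightarrow> length ys \<le> length xs"
      using longest_path_exists[OF less.prems(1) False] by metis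
    have len: "length xs \<le> n" using less.prems(3) xs(1) by blast
    have low: ?thesis if v: "v \<in> V" "2 * card {w. {v, w} \<in> H} \<le> n - 1" for v
    proof (rule delete[of "{v}"])
      have fw: "finite {w. {v, w} \<in> H}"
        by (rule finite_subset[OF _ less.prems(1)]) (use less.prems(2) in auto)
      have "{e \<in> H. e \<inter> {v} \<noteq> {}} \<subseteq> (\<lambda>w. {v, w}) ` {w. {v, w} \<in> H}"
        using less.prems(2) by (fastforce simp: card_2_iff image_iff insert_commute)
      then have "card {e \<in> H. e \<inter> {v} \<noteq> {}} \<le> card {w. {v, w} \<in> H}"
        using fw by (rule surj_card_le[rotated])
      then show "2 * card {e \<in> H. e \<inter> {v} \<noteq> {}} \<le> (n - 1) * card {v}" using v by simp
    qed (use v in auto)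
    \<comment> \<open>If both degrees exceed (\<open>n\<close> - 1)/2, they add up to at least
      \<open>n\<close>, hence to at least the number of vertices of the path, as
      \<open>longest_path_closed\<close> demands.\<close>
    consider "2 * card {w. {hd xs, w} \<in> H} \<le> n - 1" | "2 * card {w. {last xs, w} \<in> H} \<le> n - 1"
      | "length xs \<le> card {w. {hd xs, w} \<in> H} + card {w. {last xs, w} \<in> H}"
      using len by linarith
    then show ?thesis
    proof cases
      case 3
      have "{e \<in> H. e \<inter> set xs \<noteq> {}} \<subseteq> {e. e \<subseteq> set xs \<and> card e = 2}"
        using longest_path_closed[OF less.prems(2,1) xs 3] less.prems(2) by auto
      then have "card {e \<in> H. e \<inter> set xs \<noteq> {}} \<le> card {e. e \<subseteq> set xs \<and> card e = 2}"
        by (intro card_mono) auto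
      also have "\<dots> = card (set xs) choose 2" by (simp add: n_subsets)
      finally have "2 * card {e \<in> H. e \<inter> set xs \<noteq> {}} \<le> 2 * (card (set xs) choose 2)" by simp
      also have "\<dots> \<le> card (set xs) * (card (set xs) - 1)" by (simp add: choose_two)
      also have "\<dots> \<le> card (set xs) * (n - 1)"
        using len card_length[of xs] by (intro mult_left_mono) auto
      finally show ?thesis using xs by (intro delete[of "set xs"]) (auto simp: mult.commute)
    next
      case 1
      with xs(2,3) show ?thesis by (intro low[of "hd xs"]) auto
    next
      case 2
      with xs(2,3) show ?thesis by (intro low[of "last xs"]) auto
    qed
  qed
qed

section \<open>Normal forests\<close>

text \<open>A rooted forest on \<open>V\<close>, all of whose parent edges lie in \<open>H\<close>: roots have the dummy parent \<open>0\<close>,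
  which lies outside \<open>V\<close> (vertices are \<open>1, \<dots>, N\<close>), and \<open>d\<close> counts vertices on the way to the root.\<close>

definition rooted_forest :: "nat set \<Rightarrow> nat set set \<Rightarrow> (nat \<Rightarrow> nat) \<Rightarrow> (nat \<Rightarrow> nat) \<Rightarrow> bool" where
  "rooted_forest V H \<pi> d \<longleftrightarrow> \<pi> 0 = 0 \<and> d 0 = 0 \<and> (\<forall>v\<in>V. d v = Suc (d (\<pi> v)) \<and> (\<pi> v = 0 \<or> \<pi> v \<in> V \<and> {v, \<pi> v} \<in> H))"

lemma rooted_forestD:
  assumes "rooted_forest V H \<pi> d"
  shows "\<pi> 0 = 0" "d 0 = 0" "v \<in> V \<Longrightarrow> d v = Suc (d (\<pi> v))"
    and "v \<in> V \<Longrightarrow> \<pi> v \<noteq> 0 \<Longrightarrow> \<pi> v \<in> V" "v \<in> V \<Longrightarrow> \<pi> v \<noteq> 0 \<Longrightarrow> {v, \<pi> v} \<in> H"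
  using assms unfolding rooted_forest_def by auto

text \<open>Each parent step lowers the depth by exactly one, and the dummy \<open>0\<close> has
  depth 0, so it is not reached in fewer than \<open>d v\<close> steps.\<close>

lemma rooted_forest_ancestor:
  assumes "rooted_forest V H \<pi> d" "v \<in> V" "i < d v"
  shows "(\<pi> ^^ i) v \<in> V \<and> d ((\<pi> ^^ i) v) = d v - i"
  using assms(3)
proof (induction i)
  case (Suc i)
  then have IH: "(\<pi> ^^ i) v \<in> V" "d ((\<pi> ^^ i) v) = d v - i" by auto
  then have "d (\<pi> ((\<pi> ^^ i) v)) = d v - Suc i"
    using assms(1) unfolding rooted_forest_def by fastforce
  moreover from this have "\<pi> ((\<pi> ^^ i) v) \<noteq> 0"
    using Suc.prems assms(1) unfolding rooted_forest_def by (metis zero_less_diff less_irrefl)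
  then have "\<pi> ((\<pi> ^^ i) v) \<in> V"
    using rooted_forestD(4)[OF assms(1)] IH(1) by simp
  ultimately show ?case by simp
qed (use assms in auto)

text \<open>Strictly decreasing depths make the vertices distinct. For a graph without long paths
  this bounds the height of the forest.\<close>

lemma rooted_forest_root_path:
  assumes "rooted_forest V H \<pi> d" "v \<in> V"
  shows "is_path H (map (\<lambda>i. (\<pi> ^^ i) v) [0..<d v])"
proof -
  note anc = rooted_forest_ancestor[OF assms]
  have "inj_on (\<lambda>i. (\<pi> ^^ i) v) {0..<d v}"
  proof (rule inj_onI)
    fix i j assume ij: "i \<in> {0..<d v}" "j \<in> {0..<d v}" "(\<pi> ^^ i) v = (\<pi> ^^ j) v"
    then have "d v - i = d v - j" using anc by (metis atLeastLessThan_iff)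
    then show "i = j" using ij by simp
  qed
  moreover have "{(\<pi> ^^ i) v, \<pi> ((\<pi> ^^ i) v)} \<in> H" if "Suc i < d v" for i
  proof -
    have "\<pi> ((\<pi> ^^ i) v) \<noteq> 0"
      using anc[OF that] that assms(1) unfolding rooted_forest_def
      by (metis funpow.simps(2) comp_apply zero_less_diff less_irrefl)
    moreover have "(\<pi> ^^ i) v \<in> V" using anc[of i] that by simp
    ultimately show ?thesis using rooted_forestD(5)[OF assms(1)] by simp
  qed
  ultimately show ?thesis by (simp add: is_path_def distinct_map successively_conv_nth)
qed

text \<open>The subtree of \<open>u\<close> is hung below \<open>v\<close>. Consequently, in a forest of maximal total depth the
  ends of every edge of \<open>H\<close> are comparable, i.e. such a forest is normal.\<close>

lemma rooted_forest_rehang: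
  assumes F: "rooted_forest V H \<pi> d" and V: "finite V" "0 \<notin> V" and uv: "u \<in> V" "v \<in> V" "{u, v} \<in> H"
    and le: "d u \<le> d v" and incomp: "\<And>i. (\<pi> ^^ i) v \<noteq> u"
  shows "\<exists>\<pi>' d'. rooted_forest V H \<pi>' d' \<and> sum d V < sum d' V"
proof -
  \<comment> \<open>\<open>T\<close> is the subtree of \<open>u\<close>. Rehanging raises all its
    depths by the same positive amount, so that \<open>u\<close> lands just below \<open>v\<close>;
    as \<open>v\<close> lies outside \<open>T\<close>, no cycle arises.\<close>
  define T where "T = {x. \<exists>i. (\<pi> ^^ i) x = u}"
  define d' where "d' = (\<lambda>x. if x \<in> T then d x + (Suc (d v) - d u) else d x)"
  have T: "x \<in> T \<longleftrightarrow> \<pi> x \<in> T" if "x \<noteq> u" for x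
  proof
    assume "x \<in> T"
    then obtain i where i: "(\<pi> ^^ i) x = u" by (auto simp: T_def)
    with that have "i \<noteq> 0" by (metis funpow_0)
    then obtain j where "i = Suc j" using not0_implies_Suc by blast
    with i have "(\<pi> ^^ j) (\<pi> x) = u" by (simp add: funpow_swap1)
    then show "\<pi> x \<in> T" unfolding T_def by blast
  next
    assume "\<pi> x \<in> T"
    then obtain i where "(\<pi> ^^ i) (\<pi> x) = u" by (auto simp: T_def)
    then have "(\<pi> ^^ Suc i) x = u" by (simp add: funpow_swap1)
    then show "x \<in> T" unfolding T_def by blast
  qed
  have uT: "u \<in> T" unfolding T_def by (auto intro: exI[of _ 0])
  have vT: "v \<notin> T" using incomp by (simp add: T_def)
  have par: "d x = Suc (d (\<pi> x))" "\<pi> x = 0 \<or> \<pi> x \<in> V \<and> {x, \<pi> x} \<in> H"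
      if "x \<in> V" for x
    using F that unfolding rooted_forest_def by auto
  have d00: "d 0 = 0" using F by (simp add: rooted_forest_def)
  have "\<pi> 0 = 0" using F by (simp add: rooted_forest_def)
  then have "(\<pi> ^^ i) 0 = 0" for i by (induction i) auto
  moreover have "u \<noteq> 0" using uv(1) V(2) by metis
  ultimately have T0: "0 \<notin> T" by (simp add: T_def)
  have "rooted_forest V H (\<pi>(u := v)) d'"
    unfolding rooted_forest_def
  proof (intro conjI ballI)
    show "d' 0 = 0" using d00 T0 by (simp add: d'_def)
    show "(\<pi>(u := v)) 0 = 0" using \<open>\<pi> 0 = 0\<close> \<open>u \<noteq> 0\<close> by simp
    fix x assume x: "x \<in> V"
    show "d' x = Suc (d' ((\<pi>(u := v)) x))"
    proof (cases "x = u")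
      case True
      then show ?thesis using uT vT le by (simp add: d'_def)
    next
      case False
      then show ?thesis unfolding d'_def by (simp add: par(1)[OF x] T[OF False])
    qed
    show "(\<pi>(u := v)) x = 0 \<or> (\<pi>(u := v)) x \<in> V \<and> {x, (\<pi>(u := v)) x} \<in> H"
    proof (cases "x = u")
      case True
      then show ?thesis using uv by simp
    next
      case False
      then show ?thesis using par(2)[OF x] by simp
    qed
  qed
  moreover have "sum d V < sum d' V"
    using V(1)
  proof (rule sum_strict_mono_ex1)
    show "\<forall>x\<in>V. d x \<le> d' x" by (simp add: d'_def)
    have "d u < d' u" using uT le by (simp add: d'_def)
    with uv(1) show "\<exists>x\<in>V. d x < d' x" ..
  qed
  ultimately have "rooted_forest V H (\<pi>(u := v)) d' \<and> sum d V < sum d' V" ..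
  then show ?thesis by metis
qed

lemma normal_forest_exists:
  fixes V :: "nat set"
  assumes V: "finite V" "0 \<notin> V" and H: "H \<subseteq> {e. e \<subseteq> V \<and> card e = 2}"
    and n: "\<And>xs. is_path H xs \<Longrightarrow> length xs \<le> n"
  shows "\<exists>\<pi>. \<pi> 0 = 0 \<and> (\<forall>v\<in>V. \<pi> v \<in> insert 0 V) \<and> H \<subseteq> (\<lambda>(v, i). {v, (\<pi> ^^ i) v}) ` (V \<times> {1..<n})"
proof -
  let ?P = "\<lambda>(\<pi>, d). rooted_forest V H \<pi> d"
  let ?w = "\<lambda>(\<pi> :: nat \<Rightarrow> nat, d). sum d V"
  \<comment> \<open>Depths are bounded by path lengths, so total depth is bounded and some forest
    maximises it; the forest consisting of roots only shows that there is one at all.\<close>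
  have dn: "d v \<le> n" if "rooted_forest V H \<pi> d" "v \<in> V" for \<pi> d v
    using n[OF rooted_forest_root_path[OF that]] by simp
  have "?P (\<lambda>_. 0, \<lambda>v. of_bool (v \<in> V))" using V(2) by (auto simp: rooted_forest_def)
  moreover have "\<forall>y. ?P y \<longrightarrow> ?w y < Suc (card V * n)"
    using sum_bounded_above[of V _ n] dn by (auto simp: less_Suc_eq_le)
  ultimately obtain y where "?P y" "\<forall>y'. ?P y' \<longrightarrow> ?w y' \<le> ?w y"
    using ex_has_greatest_nat[of ?P _ ?w] by blast
  then obtain \<pi> d where F: "rooted_forest V H \<pi> d"
      and max: "\<And>\<pi>' d'. rooted_forest V H \<pi>' d' \<Longrightarrow> sum d' V \<le> sum d V"
    by (cases y) auto
  have edge: "e \<in> (\<lambda>(v, i). {v, (\<pi> ^^ i) v}) ` (V \<times> {1..<n})"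
    if uv: "e = {u, v}" "{u, v} \<in> H" "u \<noteq> v" "u \<in> V" "v \<in> V" "d u \<le> d v" for e u v
  proof -
    obtain i where i: "(\<pi> ^^ i) v = u"
      using rooted_forest_rehang[OF F V uv(4,5,2,6)] max not_less by blast
    \<comment> \<open>Beyond the root all iterates equal the dummy \<open>0\<close>, which is not
      the vertex \<open>u\<close>. With \<open>u\<close> \<noteq> \<open>v\<close> and
      \<open>d v\<close> \<le> \<open>n\<close> this puts \<open>i\<close> into
      \<open>{1..<n}\<close>.\<close>
    have "i < d v"
    proof (rule ccontr)
      assume "\<not> i < d v"
      have "d v \<noteq> 0" using F uv(5) by (auto simp: rooted_forest_def)
      then have a: "(\<pi> ^^ (d v - 1)) v \<in> V" "d ((\<pi> ^^ (d v - 1)) v) = 1"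
        using rooted_forest_ancestor[OF F uv(5), of "d v - 1"] by auto
      then have "\<pi> ((\<pi> ^^ (d v - 1)) v) = 0"
        using rooted_forestD(3)[OF F a(1)] rooted_forestD(3)[OF F rooted_forestD(4)[OF F a(1)]] by fastforce
      then have "(\<pi> ^^ d v) v = 0"
        using \<open>d v \<noteq> 0\<close> by (cases "d v") auto
      moreover have "\<pi> 0 = 0" using F by (simp add: rooted_forest_def)
      then have "(\<pi> ^^ k) 0 = 0" for k by (induction k) auto
      ultimately have "(\<pi> ^^ i) v = 0"
        using \<open>\<not> i < d v\<close> funpow_add[of "i - d v" "d v" \<pi>] by simp
      then show False using i uv(4) V(2) by simp
    qed
    moreover have "i \<noteq> 0" using i uv(3) by (metis funpow_0)
    ultimately show ?thesis using i uv dn[OF F uv(5)]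
      by (intro image_eqI[of _ _ "(v, i)"]) (auto simp: insert_commute)
  qed
  have "e \<in> (\<lambda>(v, i). {v, (\<pi> ^^ i) v}) ` (V \<times> {1..<n})" if e: "e \<in> H" for e
  proof -
    have "e \<subseteq> V" "card e = 2" using H e by auto
    then obtain u v where "e = {u, v}" "u \<noteq> v" "u \<in> V" "v \<in> V" by (auto simp: card_2_iff)
    then show ?thesis using edge[of e u v] edge[of e v u] e by (metis insert_commute linear)
  qed
  moreover have "\<pi> v \<in> insert 0 V" if "v \<in> V" for v
    using F that by (auto simp: rooted_forest_def)
  ultimately show ?thesis using rooted_forestD(1)[OF F] by blast
qed

section \<open>Disjoint bipartite blocks\<close>

text \<open>A path never leaves its block, and of any two consecutive vertices one lies in
  \<open>A\<close>. With 2\<open>t\<close> + 2 vertices it would contain \<open>t\<close> + 1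
  vertices of \<open>A\<close> from a single block.\<close>

lemma bipartite_blocks_path_length:
  assumes edges: "\<And>e. e \<in> H \<Longrightarrow> \<exists>b a. e = {b, a} \<and> b \<notin> A \<and> a \<in> A \<and> \<beta> b = \<beta> a"
    and block: "\<And>j. finite {a \<in> A. \<beta> a = j} \<and> card {a \<in> A. \<beta> a = j} \<le> t"
    and xs: "is_path H xs"
  shows "length xs \<le> 2 * t + 1"
proof (rule ccontr)
  assume "\<not> length xs \<le> 2 * t + 1"
  then have len: "length xs \<ge> 2 * t + 2" by simp
  have dist: "distinct xs" and adj: "Suc i < length xs \<Longrightarrow> {xs ! i, xs ! Suc i} \<in> H" for i
    using xs by (auto simp: is_path_def successively_conv_nth)
  have same: "i < length xs \<Longrightarrow> \<beta> (xs ! i) = \<beta> (xs ! 0)" for i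
  proof (induction i)
    case (Suc i)
    then show ?case using edges[OF adj[of i]] by (fastforce simp: doubleton_eq_iff)
  qed simp
  \<comment> \<open>Of the positions 2\<open>i\<close> and 2\<open>i\<close> + 1, \<open>k i\<close>
    picks the one in \<open>A\<close>; halving it recovers \<open>i\<close>, which gives
    injectivity.\<close>
  define k where "k = (\<lambda>i. if xs ! (2 * i) \<in> A then 2 * i else Suc (2 * i))"
  have k: "k i div 2 = i" for i by (simp add: k_def)
  have kl: "k i < length xs \<and> xs ! k i \<in> A" if "i \<le> t" for i
  proof -
    have l: "Suc (2 * i) < length xs" using that len by simp
    from edges[OF adj[OF l]] l show ?thesis by (auto simp: k_def doubleton_eq_iff)
  qed
  have "inj_on (\<lambda>i. xs ! k i) {..t}"
  proof (rule inj_onI)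
    fix i i' assume "i \<in> {..t}" "i' \<in> {..t}" "xs ! k i = xs ! k i'"
    then have "k i = k i'" using kl nth_eq_iff_index_eq[OF dist] by auto
    then show "i = i'" using k by metis
  qed
  then have "Suc t \<le> card {a \<in> A. \<beta> a = \<beta> (xs ! 0)}"
    using card_inj_on_le[of "\<lambda>i. xs ! k i" "{..t}" "{a \<in> A. \<beta> a = \<beta> (xs ! 0)}"] block kl same
    by auto
  then show False using block[of "\<beta> (xs ! 0)"] by simp
qed

text \<open>The vertices \<open>1, \<dots>, m s r\<close> are cut into consecutive cells of size \<open>r\<close>, and the cells into
  \<open>m\<close> blocks of \<open>s\<close> consecutive cells.\<close>

definition cell :: "nat \<Rightarrow> nat \<Rightarrow> nat set" where
  "cell r q = {q * r<..q * r + r}"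

definition hits_block :: "nat \<Rightarrow> nat \<Rightarrow> nat set set \<Rightarrow> nat \<Rightarrow> nat \<Rightarrow> bool" where
  "hits_block r s G b j \<longleftrightarrow> (\<forall>i<s. \<exists>a\<in>cell r (j * s + i). {b, a} \<in> G)"

lemma card_cell [simp]: "card (cell r q) = r" and finite_cell [simp]: "finite (cell r q)"
  by (simp_all add: cell_def)

lemma cell_div:
  assumes "a \<in> cell r q" shows "(a - 1) div r = q"
proof -
  from assms have "q * r \<le> a - 1" "a - 1 < q * r + r" by (auto simp: cell_def)
  then show ?thesis by (intro div_nat_eqI) (auto simp: mult.commute)
qed

lemma cell_block_div:
  assumes "a \<in> cell r (j * s + i)" "i < s" shows "(a - 1) div (s * r) = j"
  using cell_div[OF assms(1)] assms(2) by (simp add: mult.commute[of s] div_mult2_eq)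

lemma cell_subset:
  assumes "j < m" "i < s" shows "cell r (j * s + i) \<subseteq> {1..m * s * r}"
proof
  fix a assume a: "a \<in> cell r (j * s + i)"
  have "j * s + i + 1 \<le> Suc j * s" using assms(2) by simp
  also have "\<dots> \<le> m * s" using assms(1) by (intro mult_right_mono) auto
  finally have "(j * s + i + 1) * r \<le> m * s * r" by (rule mult_right_mono) simp
  with a show "a \<in> {1..m * s * r}" by (auto simp: cell_def algebra_simps)
qed

text \<open>Each successful vertex commits to one block that it hits, and only edges within a block
  are kept. Cells are disjoint, so each such vertex contributes \<open>s\<close> distinct
  edges.\<close>

lemma hits_block_subgraph:
  assumes G: "finite G" and rs: "0 < r" "0 < s"
  shows "\<exists>H\<subseteq>G. s * card {b \<in> {m * s * r<..N}. \<exists>j<m. hits_block r s G b j} \<le> card H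
           \<and> (\<forall>xs. is_path H xs \<longrightarrow> length xs \<le> 2 * (s * r) + 1)"
proof -
  define A where "A = {1..m * s * r}"
  define Z where "Z = {b \<in> {m * s * r<..N}. \<exists>j<m. hits_block r s G b j}"
  have "\<forall>b\<in>Z. \<exists>j<m. hits_block r s G b j" by (simp add: Z_def)
  then obtain J where J: "\<And>b. b \<in> Z \<Longrightarrow> J b < m \<and> hits_block r s G b (J b)" by metis
  \<comment> \<open>Outside \<open>A\<close> and \<open>Z\<close> the block \<open>J v\<close> is
    arbitrary. Edges kept at such vertices do no harm, since they still stay within a single
    block.\<close>
  define \<beta> where "\<beta> = (\<lambda>v. if v \<in> A then (v - 1) div (s * r) else J v)"
  define H where "H = {e \<in> G. \<exists>b a. e = {b, a} \<and> b \<notin> A \<and> a \<in> A \<and> \<beta> b = \<beta> a}"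
  have len: "length xs \<le> 2 * (s * r) + 1" if "is_path H xs" for xs
  proof (rule bipartite_blocks_path_length[OF _ _ that])
    fix j
    have "{a \<in> A. \<beta> a = j} \<subseteq> {j * (s * r)<..j * (s * r) + s * r}"
    proof
      fix a assume "a \<in> {a \<in> A. \<beta> a = j}"
      then have "a > 0" "(a - 1) div (s * r) = j" by (auto simp: \<beta>_def A_def)
      moreover have "s * r > 0" using rs by simp
      ultimately show "a \<in> {j * (s * r)<..j * (s * r) + s * r}"
        using div_mult_mod_eq[of "a - 1" "s * r"] mod_less_divisor[OF \<open>s * r > 0\<close>, of "a - 1"]
        by (simp only: greaterThanAtMost_iff) linarith
    qed
    from card_mono[OF _ this] finite_subset[OF this]
    show "finite {a \<in> A. \<beta> a = j} \<and> card {a \<in> A. \<beta> a = j} \<le> s * r" by simp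
  qed (auto simp: H_def)
  define a where "a = (\<lambda>b i. SOME a. a \<in> cell r (J b * s + i) \<and> {b, a} \<in> G)"
  have a: "a b i \<in> cell r (J b * s + i) \<and> {b, a b i} \<in> G" if "b \<in> Z" "i < s" for b i
    unfolding a_def by (rule someI_ex) (use J[OF that(1)] that(2) in \<open>auto simp: hits_block_def\<close>)
  have aA: "a b i \<in> A" if "b \<in> Z" "i < s" for b i
    using a[OF that] cell_subset[of "J b" m i s r] J[OF that(1)] that(2) by (auto simp: A_def)
  have ZA: "b \<notin> A" if "b \<in> Z" for b using that by (auto simp: Z_def A_def)
  have "card (Z \<times> {..<s}) \<le> card H"
  proof (rule card_inj_on_le[where f = "\<lambda>(b, i). {b, a b i}"])
    show "inj_on (\<lambda>(b, i). {b, a b i}) (Z \<times> {..<s})"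
    proof (rule inj_onI, clarsimp)
      fix b i b' i' assume *: "b \<in> Z" "i < s" "b' \<in> Z" "i' < s" "{b, a b i} = {b', a b' i'}"
      then have eq: "b = b'" "a b i = a b' i'"
        using aA[of b i] aA[of b' i'] ZA[of b] ZA[of b'] by (auto simp: doubleton_eq_iff)
      have 1: "a b i \<in> cell r (J b * s + i)" using a[OF *(1,2)] by simp
      have 2: "a b i \<in> cell r (J b * s + i')" unfolding eq(2) using a[OF *(3,4)] eq(1) by simp
      have "J b * s + i = J b * s + i'" using cell_div[OF 1] cell_div[OF 2] by metis
      with eq show "b = b' \<and> i = i'" by simp
    qed
    show "(\<lambda>(b, i). {b, a b i}) ` (Z \<times> {..<s}) \<subseteq> H"
    proof clarsimp
      fix b i assume bi: "b \<in> Z" "i < s"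
      have "\<beta> b = \<beta> (a b i)"
        using aA[OF bi] ZA[OF bi(1)] cell_block_div[of "a b i" r "J b" s i] a[OF bi] bi(2) by (simp add: \<beta>_def)
      then show "{b, a b i} \<in> H"
        using aA[OF bi] ZA[OF bi(1)] a[OF bi] unfolding H_def by blast
    qed
    show "finite H" using G by (simp add: H_def)
  qed
  then have "s * card Z \<le> card H" by (simp add: card_cartesian_product mult.commute)
  moreover have "H \<subseteq> G" by (auto simp: H_def)
  ultimately show ?thesis unfolding Z_def using len by (intro exI[of _ H] conjI allI impI)
qed

text \<open>A cell is missed with probability (1 - \<open>p\<close>)^\<open>r\<close>. Since
  \<open>b\<close> lies beyond all cells, the pairs joining it to different cells are distinct
  genuine pairs, so independence applies first to the cells of a block and then to the
  blocks.\<close>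

lemma prob_hits_block:
  fixes p :: real
  assumes p: "0 \<le> p" "p \<le> 1" and rs: "0 < r" "0 < s" and b: "b \<in> {m * s * r<..N}"
  shows "measure_pmf.prob (Pi_pmf (all_pairs N) False (\<lambda>_. bernoulli_pmf p))
      {f. \<exists>j<m. hits_block r s {e. f e} b j} = 1 - (1 - (1 - (1 - p) ^ r) ^ s) ^ m"
proof -
  let ?P = "measure_pmf.prob (Pi_pmf (all_pairs N) False (\<lambda>_. bernoulli_pmf p))"
  define D where "D = (\<lambda>q. (\<lambda>a. {b, a}) ` cell r q)"
  have D: "D (j * s + i) \<subseteq> all_pairs N" if "j < m" "i < s" for j i
    using cell_subset[OF that, of r] b unfolding D_def all_pairs_def
    by (auto simp: edge_distinct) 
  have inj: "inj (\<lambda>a. {b, a})" by (auto simp: inj_on_def doubleton_eq_iff)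
  have Dd: "q = q'" if xq: "x \<in> D q" "x \<in> D q'" for q q' x
  proof -
    obtain a a' where a: "a \<in> cell r q" "a' \<in> cell r q'" "x = {b, a}" "x = {b, a'}"
      using xq unfolding D_def by blast
    then have "a = a'" by (auto simp: doubleton_eq_iff)
    then show ?thesis using cell_div[OF a(1)] cell_div[OF a(2)] by simp
  qed
  have hit: "hits_block r s {e. f e} b j \<longleftrightarrow> (\<forall>i\<in>{..<s}. \<exists>e\<in>D (j * s + i). f e)" for f j
    by (auto simp: hits_block_def D_def)
  have c: "?P {f. \<exists>e\<in>D (j * s + i). f e} = 1 - (1 - p) ^ r" if "j < m" "i < s" for j i
  proof -
    have "card (D (j * s + i)) = r" unfolding D_def using inj by (subst card_image) (auto intro: inj_on_subset)
    then have "?P {f. \<forall>e\<in>D (j * s + i). f e = False} = (1 - p) ^ r"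
      using prob_Pi_bernoulli_all[OF finite_all_pairs D[OF that] p, of False False] by simp
    moreover have "{f. \<exists>e\<in>D (j * s + i). f e} = UNIV - {f. \<forall>e\<in>D (j * s + i). f e = False}" by auto
    ultimately show ?thesis
      using measure_pmf.prob_compl[of "{f. \<forall>e\<in>D (j * s + i). f e = False}" "Pi_pmf (all_pairs N) False (\<lambda>_. bernoulli_pmf p)"]
      by simp
  qed
  have blk: "?P {f. hits_block r s {e. f e} b j} = (1 - (1 - p) ^ r) ^ s" if "j < m" for j
  proof -
    have "?P {f. \<forall>i\<in>{..<s}. \<exists>e\<in>D (j * s + i). f e} = (\<Prod>i<s. ?P {f. \<exists>e\<in>D (j * s + i). f e})"
      by (rule prob_Pi_pmf_blocks[where S = "\<lambda>i. D (j * s + i)"])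
         (use D that in \<open>auto simp: disjoint_family_on_def dest: Dd\<close>)
    then show ?thesis using c that by (simp add: hit)
  qed
  have "?P {f. \<forall>j\<in>{..<m}. \<not> hits_block r s {e. f e} b j} = (\<Prod>j<m. ?P {f. \<not> hits_block r s {e. f e} b j})"
  proof (rule prob_Pi_pmf_blocks[where S = "\<lambda>j. \<Union>i<s. D (j * s + i)"])
    show "disjoint_family_on (\<lambda>j. \<Union>i<s. D (j * s + i)) {..<m}"
      unfolding disjoint_family_on_def
    proof (intro ballI impI, rule ccontr)
      fix j j' assume "j \<noteq> j'" "(\<Union>i<s. D (j * s + i)) \<inter> (\<Union>i<s. D (j' * s + i)) \<noteq> {}"
      then obtain i i' x where i: "i < s" "i' < s" "x \<in> D (j * s + i)" "x \<in> D (j' * s + i')" by auto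
      from Dd[OF i(3,4)] have "(j * s + i) div s = (j' * s + i') div s" by simp
      with i \<open>j \<noteq> j'\<close> show False by simp
    qed
    fix j f assume "j \<in> {..<m}"
    show "(\<not> hits_block r s {e. f e} b j) = (\<not> hits_block r s {e. restrict f (\<Union>i<s. D (j * s + i)) e} b j)"
      unfolding hit by (auto simp: restrict_def)
  qed (use D in auto)
  also have "\<dots> = (\<Prod>j<m. 1 - (1 - (1 - p) ^ r) ^ s)"
  proof (rule prod.cong[OF refl])
    fix j assume "j \<in> {..<m}"
    then show "?P {f. \<not> hits_block r s {e. f e} b j} = 1 - (1 - (1 - p) ^ r) ^ s"
      using blk[of j] measure_pmf.prob_compl[of "{f. hits_block r s {e. f e} b j}" "Pi_pmf (all_pairs N) False (\<lambda>_. bernoulli_pmf p)"]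
      by (simp add: Compl_eq_Diff_UNIV[symmetric] Collect_neg_eq)
  qed
  finally have "?P {f. \<forall>j\<in>{..<m}. \<not> hits_block r s {e. f e} b j} = (1 - (1 - (1 - p) ^ r) ^ s) ^ m" by simp
  moreover have "{f. \<exists>j<m. hits_block r s {e. f e} b j} = UNIV - {f. \<forall>j\<in>{..<m}. \<not> hits_block r s {e. f e} b j}" by auto
  ultimately show ?thesis
    using measure_pmf.prob_compl[of "{f. \<forall>j\<in>{..<m}. \<not> hits_block r s {e. f e} b j}" "Pi_pmf (all_pairs N) False (\<lambda>_. bernoulli_pmf p)"]
    by simp
qed

text \<open>The successes of different vertices \<open>b\<close> depend on disjoint sets of pairs,
  so Hoeffding's inequality bounds their number below by a \<open>\<delta>\<close> fraction, and
  each success is worth \<open>s\<close> edges.\<close>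

lemma prob_ex_graph_path_ge:
  fixes p :: real
  assumes p: "0 \<le> p" "p \<le> 1" and rs: "0 < r" "0 < s" and n: "2 * (s * r) + 1 \<le> n" and M: "m * s * r < N"
    and q: "1 - (1 - (1 - (1 - p) ^ r) ^ s) ^ m \<ge> \<delta> + \<epsilon>" and e: "0 \<le> \<epsilon>"
  shows "measure_pmf.prob (gnp N p)
     {G. s * (\<delta> * real (N - m * s * r)) \<le> ex_graph G (path_vertices (n + 1)) (path_edges (n + 1))}
     \<ge> 1 - exp (- 2 * \<epsilon>\<^sup>2 * real (N - m * s * r))"
proof -
  let ?Q = "Pi_pmf (all_pairs N) False (\<lambda>_. bernoulli_pmf p)"
  let ?ex = "\<lambda>G. ex_graph G (path_vertices (n + 1)) (path_edges (n + 1))"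
  define B where "B = {m * s * r<..N}"
  define g where "g = (\<lambda>b (f :: nat set \<Rightarrow> bool). \<exists>j<m. hits_block r s {e. f e} b j)"
  define A where "A = {1..m * s * r}"
  have cellA: "a \<in> A" if "j < m" "i < s" "a \<in> cell r (j * s + i)" for a j i
    using cell_subset[OF that(1,2), of r] that(3) by (auto simp: A_def)
  have cB: "card B = N - m * s * r" by (simp add: B_def)
  have ind: "prob_space.indep_vars (measure_pmf ?Q) (\<lambda>_. count_space UNIV) g B"
  proof (rule indep_vars_Pi_pmf_blocks[OF finite_all_pairs, where S = "\<lambda>b. (\<lambda>a. {b, a}) ` A"])
    show "(\<lambda>a. {b, a}) ` A \<subseteq> all_pairs N" if "b \<in> B" for b
      using that by (auto simp: A_def B_def all_pairs_def edge_distinct)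
    show "disjoint_family_on (\<lambda>b. (\<lambda>a. {b, a}) ` A) B"
      by (fastforce simp: disjoint_family_on_def A_def B_def doubleton_eq_iff)
    fix b f assume "b \<in> B"
    show "g b f = g b (restrict f ((\<lambda>a. {b, a}) ` A))"
      unfolding g_def hits_block_def
      by (intro ex_cong conj_cong all_cong bex_cong refl) (auto dest: cellA)
  qed
  have "measure_pmf.prob ?Q {f. real (card {b \<in> B. g b f}) \<le> \<delta> * card B} \<le> exp (- 2 * \<epsilon>\<^sup>2 * card B)"
  proof (rule Hoeffding_count_le[OF ind _ _ _ e])
    show "B \<noteq> {}" using M by (simp add: B_def)
    show "\<delta> + \<epsilon> \<le> measure_pmf.prob ?Q {f. g b f}" if "b \<in> B" for b
      using prob_hits_block[OF p rs, of b m N] that q by (simp add: g_def B_def)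
  qed (simp add: B_def)
  moreover have "1 - measure_pmf.prob ?Q {f. real (card {b \<in> B. g b f}) \<le> \<delta> * card B}
      \<le> measure_pmf.prob (gnp N p) {G. s * (\<delta> * card B) \<le> ?ex G}"
  proof -
    have "1 - measure_pmf.prob ?Q {f. real (card {b \<in> B. g b f}) \<le> \<delta> * card B}
        = measure_pmf.prob ?Q (UNIV - {f. real (card {b \<in> B. g b f}) \<le> \<delta> * card B})"
      using measure_pmf.prob_compl[of "{f. real (card {b \<in> B. g b f}) \<le> \<delta> * card B}" ?Q] by simp
    also have "\<dots> \<le> measure_pmf.prob ?Q {f. s * (\<delta> * card B) \<le> ?ex {e \<in> all_pairs N. f e}}"
    proof (intro measure_pmf.finite_measure_mono subsetI)
      fix f assume "f \<in> UNIV - {f. real (card {b \<in> B. g b f}) \<le> \<delta> * card B}"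
      then have f: "\<delta> * card B \<le> card {b \<in> B. g b f}" by simp
      define G where "G = {e \<in> all_pairs N. f e}"
      have G: "finite G" by (simp add: G_def)
      \<comment> \<open>\<open>g\<close> reads \<open>f\<close> on arbitrary sets and
        \<open>G\<close> keeps only genuine pairs, but only pairs \<open>{b, a}\<close> with
        \<open>a\<close> in \<open>A\<close> are ever consulted.\<close>
      have gG: "g b f \<longleftrightarrow> (\<exists>j<m. hits_block r s G b j)" if "b \<in> B" for b
      proof -
        have "{b, a} \<in> all_pairs N" if "a \<in> A" for a
          using that \<open>b \<in> B\<close> by (auto simp: A_def B_def all_pairs_def edge_distinct)
        then show ?thesis
          unfolding g_def hits_block_def G_def
          by (intro ex_cong conj_cong all_cong bex_cong refl) (auto dest: cellA)
      qed
      obtain H where H: "H \<subseteq> G" "s * card {b \<in> B. \<exists>j<m. hits_block r s G b j} \<le> card H"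
          "\<And>xs. is_path H xs \<Longrightarrow> length xs \<le> 2 * (s * r) + 1"
        using hits_block_subgraph[OF G rs, of m N] unfolding B_def by blast
      have "\<not> contains_copy H (path_vertices (n + 1)) (path_edges (n + 1))"
        unfolding contains_copy_path_iff using H(3) n by fastforce
      then have "card H \<le> ?ex G" by (rule card_le_ex_graph[OF G H(1)])
      moreover have "{b \<in> B. g b f} = {b \<in> B. \<exists>j<m. hits_block r s G b j}" using gG by blast
      ultimately have "s * card {b \<in> B. g b f} \<le> ?ex G" using H(2) by simp
      then have "real s * card {b \<in> B. g b f} \<le> ?ex G" by (metis of_nat_le_iff of_nat_mult)
      moreover have "s * (\<delta> * card B) \<le> real s * card {b \<in> B. g b f}"
          using f by (intro mult_left_mono) auto
      ultimately show "f \<in> {f. s * (\<delta> * card B) \<le> ?ex {e \<in> all_pairs N. f e}}"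
        by (simp add: G_def)
    qed simp
    finally show ?thesis by (simp add: prob_gnp)
  qed
  ultimately show ?thesis unfolding cB by linarith
qed

section \<open>First moment over normal forests\<close>

text \<open>Union bound over parent maps: every path-free subgraph lies in the set
  \<open>E \<pi>\<close> of vertex-ancestor pairs of a normal forest, and there are
  (\<open>N\<close> + 1)^\<open>N\<close> maps to consider.\<close>

lemma prob_ex_graph_path_gt:
  fixes p :: real
  assumes p: "0 \<le> p" "p \<le> 1" and n: "n > 0"
  shows "measure_pmf.prob (gnp N p)
     {G. t \<le> ex_graph G (path_vertices (n + 1)) (path_edges (n + 1))}
     \<le> real (N + 1) ^ N * (real ((n * N) choose t) * p ^ t)"
proof -
  define V where "V = {1..N}"
  define F where "F = PiE V (\<lambda>_. insert 0 V)"
  \<comment> \<open>Members of \<open>F\<close> are undefined outside \<open>V\<close>; extending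
    them by \<open>0\<close> restores the iteration of the parent map, whose dummy \<open>0\<close>
    is a fixed point.\<close>
  define E where "E = (\<lambda>\<pi> :: nat \<Rightarrow> nat. (\<lambda>(v, i). {v, ((\<lambda>v.
      if v \<in> V then \<pi> v else 0) ^^ i) v}) ` (V \<times> {1..<n}))"
  have F: "finite F" "card F = (N + 1) ^ N" by (auto simp: F_def V_def card_PiE finite_PiE)
  have E: "finite (E \<pi>)" "card (E \<pi>) \<le> n * N" for \<pi>
  proof -
    show "finite (E \<pi>)" by (simp add: E_def V_def)
    have "card (E \<pi>) \<le> card (V \<times> {1..<n})" unfolding E_def by (rule card_image_le) (simp add: V_def)
    also have "\<dots> \<le> n * N" by (simp add: V_def card_cartesian_product)
    finally show "card (E \<pi>) \<le> n * N" .
  qed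
  have "measure_pmf.prob (gnp N p) {G. t \<le> ex_graph G (path_vertices (n + 1)) (path_edges (n + 1))}
      \<le> measure_pmf.prob (gnp N p) (\<Union>\<pi>\<in>F. {G. t \<le> card (G \<inter> E \<pi>)})"
  proof (rule measure_pmf.finite_measure_mono_AE)
    show "AE G in gnp N p. G \<in> {G. t \<le> ex_graph G (path_vertices (n + 1)) (path_edges (n + 1))}
        \<longrightarrow> G \<in> (\<Union>\<pi>\<in>F. {G. t \<le> card (G \<inter> E \<pi>)})"
    proof (rule AE_pmfI, rule impI)
      fix G assume G: "G \<in> set_pmf (gnp N p)" "G \<in> {G. t \<le> ex_graph G (path_vertices (n + 1)) (path_edges (n + 1))}"
      have GN: "G \<subseteq> all_pairs N" using G(1) by (rule set_pmf_gnp)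
      then have fG: "finite G" using finite_all_pairs finite_subset by blast
      have "path_edges (n + 1) \<noteq> {}" using n path_edges_nonempty[of n] by simp
      then obtain H where H: "H \<subseteq> G" "\<not> contains_copy H (path_vertices (n + 1)) (path_edges (n + 1))"
          "ex_graph G (path_vertices (n + 1)) (path_edges (n + 1)) = card H"
        by (rule ex_graph_attained[OF fG])
      have "length xs \<le> n" if "is_path H xs" for xs
        using path_free_length_le[of H n xs] H(2) that by simp
      moreover have "H \<subseteq> {e. e \<subseteq> V \<and> card e = 2}"
          using H(1) GN by (auto simp: all_pairs_def V_def)
      ultimately obtain \<pi> where \<pi>: "\<forall>v\<in>V. \<pi> v \<in> insert 0 V" "\<pi> 0 = 0"
          "H \<subseteq> (\<lambda>(v, i). {v, (\<pi> ^^ i) v}) ` (V \<times> {1..<n})"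
        using normal_forest_exists[of V H n] by (auto simp: V_def)
      have F': "restrict \<pi> V \<in> F" using \<pi>(1) by (auto simp: F_def)
      have "0 \<notin> V" by (simp add: V_def)
      then have "((\<lambda>v. if v \<in> V then restrict \<pi> V v else 0) ^^ i) v = (\<pi> ^^ i) v \<and> (\<pi> ^^ i) v \<in> insert 0 V" if "v \<in> V" for i v
        by (induction i) (use that \<pi>(1,2) in auto)
      then have "E (restrict \<pi> V) = (\<lambda>(v, i). {v, (\<pi> ^^ i) v}) ` (V \<times> {1..<n})"
        unfolding E_def by (intro image_cong refl) auto
      then have "H \<subseteq> G \<inter> E (restrict \<pi> V)" using H(1) \<pi>(3) by simp
      then have "card H \<le> card (G \<inter> E (restrict \<pi> V))" using fG by (intro card_mono) auto
      then have "t \<le> card (G \<inter> E (restrict \<pi> V))" using G(2) H(3) by simp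
      with F' show "G \<in> (\<Union>\<pi>\<in>F. {G. t \<le> card (G \<inter> E \<pi>)})" by blast
    qed
  qed simp
  also have "\<dots> \<le> (\<Sum>\<pi>\<in>F. measure_pmf.prob (gnp N p) {G. t \<le> card (G \<inter> E \<pi>)})"
    by (rule measure_pmf.finite_measure_subadditive_finite[OF F(1)]) auto
  also have "\<dots> \<le> (\<Sum>\<pi>\<in>F. real ((n * N) choose t) * p ^ t)"
  proof (rule sum_mono)
    fix \<pi>
    have "measure_pmf.prob (gnp N p) {G. t \<le> card (G \<inter> E \<pi>)} \<le> (card (E \<pi>) choose t) * p ^ t"
      by (rule prob_gnp_many_edges_le[OF p E(1)])
    also have "\<dots> \<le> real ((n * N) choose t) * p ^ t"
      using binomial_right_mono[OF E(2)] p by (intro mult_right_mono) auto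
    finally show "measure_pmf.prob (gnp N p) {G. t \<le> card (G \<inter> E \<pi>)} \<le> real ((n * N) choose t) * p ^ t" .
  qed
  also have "\<dots> = real (N + 1) ^ N * (real ((n * N) choose t) * p ^ t)"
    using F(2) by simp
  finally show ?thesis .
qed

text \<open>The single term \<open>t\<close>^\<open>t\<close> / \<open>t\<close>! of the exponential
  series is at most exp \<open>t\<close>.\<close>

lemma binomial_le_exp_power:
  assumes "0 < t"
  shows "real (M choose t) \<le> (exp 1 * M / t) ^ t"
proof -
  have "(\<Sum>n\<in>{t}. real t ^ n / fact n) \<le> (\<Sum>n. real t ^ n / fact n)"
    using summable_exp_generic[of "real t"] by (intro sum_le_suminf) (auto simp: divide_inverse mult.commute)
  then have "real t ^ t / fact t \<le> exp (real t)"
    by (simp add: exp_def divide_inverse mult.commute)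
  then have e: "real t ^ t \<le> fact t * exp (real t)" by (simp add: field_simps)
  have "real ((M choose t) * fact t) \<le> real (M ^ t)"
    using binomial_fact_pow[of M t] by (simp only: of_nat_le_iff)
  then have "real (M choose t) * fact t * exp (real t) \<le> real M ^ t * exp (real t)"
    by (intro mult_right_mono) auto
  moreover have "real (M choose t) * real t ^ t \<le> real (M choose t) * fact t * exp (real t)"
    using e unfolding mult.assoc by (rule mult_left_mono) simp
  ultimately have "real (M choose t) * real t ^ t \<le> real M ^ t * exp (real t)"
    by linarith
  moreover have "exp (real t) = exp 1 ^ t" by (simp flip: exp_of_nat_mult)
  ultimately show ?thesis
    using assms by (simp add: power_mult_distrib power_divide field_simps)
qed

section \<open>The dense regime\<close>

text \<open>At most half of the vertices are spent on blocks, and \<open>c\<close> is a lower bound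
  for the expected number of blocks hit by a remaining vertex, which therefore fails with
  probability at most exp(-\<open>c\<close>). Deviation 1/100 over at least \<open>N\<close>/2
  vertices yields the exponent \<open>N\<close> / 10^4.\<close>

lemma prob_ex_graph_path_ge_linear:
  fixes p c \<delta> :: real
  assumes p: "0 < p" "p \<le> 1" and rs: "0 < r" "0 < s" and n: "2 * (s * r) + 1 \<le> n" and N: "0 < N"
    and c: "c \<le> real (N div (2 * (s * r))) * (r * p / (1 + r * p)) ^ s"
    and \<delta>: "\<delta> + 1/100 \<le> 1 - exp (- c)" "0 \<le> \<delta>"
  shows "measure_pmf.prob (gnp N p)
     {G. s * \<delta> * real N / 2 \<le> ex_graph G (path_vertices (n + 1)) (path_edges (n + 1))}
     \<ge> 1 - exp (- real N / 10 ^ 4)"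
proof -
  define m where "m = N div (2 * (s * r))"
  have m2: "2 * (m * s * r) \<le> N"
    using div_times_less_eq_dividend[of N "2 * (s * r)"] by (simp add: m_def mult_ac)
  then have half: "real N / 2 \<le> real (N - m * s * r)" by linarith
  define a where "a = 1 - (1 - p) ^ r"
  have "r * p / (1 + r * p) \<le> a"
  proof -
    \<comment> \<open>By Bernoulli's inequality this is at most (1 -
      \<open>p\<close>^2)^\<open>r\<close>, so (1 - \<open>p\<close>)^\<open>r\<close> \<le> 1 / (1
      + \<open>r p\<close>).\<close>
    have "(1 + r * p) * (1 - p) ^ r \<le> (1 + p) ^ r * (1 - p) ^ r"
      using p Bernoulli_inequality[of p r] by (intro mult_right_mono) auto
    also have "\<dots> = (1 - p\<^sup>2) ^ r" by (simp add: power_mult_distrib[symmetric] algebra_simps power2_eq_square)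
    also have "\<dots> \<le> 1" using p by (intro power_le_one) (auto simp: power_le_one)
    finally have "r * p \<le> a * (1 + r * p)" by (simp add: a_def algebra_simps)
    moreover have "0 < 1 + r * p" using p by (intro add_pos_nonneg) auto
    ultimately show ?thesis by (simp add: pos_divide_le_eq)
  qed
  then have "(r * p / (1 + r * p)) ^ s \<le> a ^ s"
    using p by (intro power_mono) auto
  then have "c \<le> m * a ^ s"
    using c mult_left_mono[of _ _ "real m"] unfolding m_def by (meson of_nat_0_le_iff order_trans)
  have a01: "0 \<le> a" "a \<le> 1" using p by (auto simp: a_def power_le_one)
  have "(1 - a ^ s) ^ m \<le> exp (- (a ^ s)) ^ m"
    using exp_ge_add_one_self[of "- (a ^ s)"] a01 by (intro power_mono) (auto simp: power_le_one)
  also have "\<dots> = exp (- (m * a ^ s))" by (simp flip: exp_of_nat_mult)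
  also have "\<dots> \<le> exp (- c)" using \<open>c \<le> m * a ^ s\<close> by simp
  finally have q: "\<delta> + 1/100 \<le> 1 - (1 - (1 - (1 - p) ^ r) ^ s) ^ m" using \<delta> by (simp add: a_def)
  have "m * s * r < N" using m2 N by linarith
  from prob_ex_graph_path_ge[OF less_imp_le[OF p(1)] p(2) rs n this q]
  have "1 - exp (- 2 * (1/100)\<^sup>2 * real (N - m * s * r))
     \<le> measure_pmf.prob (gnp N p) {G. s * (\<delta> * real (N - m * s * r)) \<le> ex_graph G (path_vertices (n + 1)) (path_edges (n + 1))}"
    by simp
  also have "\<dots> \<le> measure_pmf.prob (gnp N p) {G. s * \<delta> * real N / 2 \<le> ex_graph G (path_vertices (n + 1)) (path_edges (n + 1))}"
  proof (intro measure_pmf.finite_measure_mono subsetI)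
    have "s * \<delta> * real N / 2 = s * (\<delta> * (real N / 2))" by simp
    also have "\<dots> \<le> s * (\<delta> * real (N - m * s * r))"
      using half \<delta>(2) by (intro mult_left_mono) auto
    finally show "G \<in> {G. s * \<delta> * real N / 2 \<le> ex_graph G (path_vertices (n + 1)) (path_edges (n + 1))}"
      if "G \<in> {G. s * (\<delta> * real (N - m * s * r)) \<le> ex_graph G (path_vertices (n + 1)) (path_edges (n + 1))}" for G
      using that by simp
  qed simp
  finally have "1 - exp (- 2 * (1/100)\<^sup>2 * real (N - m * s * r))
      \<le> measure_pmf.prob (gnp N p) {G. s * \<delta> * real N / 2 \<le> ex_graph G (path_vertices (n + 1)) (path_edges (n + 1))}" .
  moreover have "- 2 * (1/100)\<^sup>2 * real (N - m * s * r) \<le> - real N / 10 ^ 4"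
    using half by (simp add: power2_eq_square)
  ultimately show ?thesis by (smt (verit) exp_le_cancel_iff)
qed

lemma ex_graph_path_le_Erdos_Gallai:
  assumes G: "G \<in> set_pmf (gnp N p)" and n: "n > 0"
  shows "real (ex_graph G (path_vertices (n + 1)) (path_edges (n + 1))) \<le> 1/2 * real n * real N"
proof -
  have GN: "G \<subseteq> all_pairs N" using G by (rule set_pmf_gnp)
  then have fG: "finite G" using finite_all_pairs finite_subset by blast
  have "path_edges (n + 1) \<noteq> {}" using n path_edges_nonempty[of n] by simp
  then obtain H where H: "H \<subseteq> G" "\<not> contains_copy H (path_vertices (n + 1)) (path_edges (n + 1))"
      "ex_graph G (path_vertices (n + 1)) (path_edges (n + 1)) = card H"
    by (rule ex_graph_attained[OF fG])
  have "2 * card H \<le> (n - 1) * card {1..N}"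
    using path_free_length_le[of H n] H(1,2) GN by (intro Erdos_Gallai_path) (auto simp: all_pairs_def)
  also have "\<dots> \<le> n * N" by simp
  finally have "real (2 * card H) \<le> real (n * N)" by (rule of_nat_mono)
  then show ?thesis using H(3) by simp
qed

lemma div_ge_half:
  assumes "0 < d" "d \<le> (N :: nat)"
  shows "real N / (2 * real d) \<le> real (N div d)"
proof -
  have "N < 2 * d * (N div d)"
  proof -
    have "N < d * (N div d) + d" using dividend_less_times_div[of d N] assms by simp
    moreover have "d \<le> d * (N div d)" using assms by (simp add: div_greater_zero_iff Suc_leI)
    ultimately have "N < 2 * (d * (N div d))" by linarith
    then show ?thesis by (simp only: mult.assoc)
  qed
  then have "real N < real (2 * d * (N div d))" by (rule of_nat_less_iff[THEN iffD2])
  then show ?thesis using assms by (simp add: field_simps)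
qed

lemma large_N:
  assumes n: "n > 0" and N: "real N \<ge> real n * exp (2 * real n)"
  shows "real n \<le> real N" "2 * real n \<le> ln (real N)" "5 * real n \<le> real N"
proof -
  have "1 * exp (2 * real n) \<le> real n * exp (2 * real n)" using n by (intro mult_right_mono) auto
  then have eN: "exp (2 * real n) \<le> real N" using N by linarith
  have "1 + 2 * real n + (2 * real n)\<^sup>2 / 2 \<le> exp (2 * real n)" by (rule exp_lower_Taylor_quadratic) simp
  moreover have "1 \<le> real n" using n by simp
  moreover from this have "1 \<le> (real n)\<^sup>2" by (rule one_le_power)
  ultimately have "5 \<le> exp (2 * real n)" by (simp add: power_mult_distrib del: one_le_power)
  then have "real n * 5 \<le> real n * exp (2 * real n)" by (intro mult_left_mono) auto
  then show "5 * real n \<le> real N" using N by linarith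
  then show "real n \<le> real N" using n by simp
  then show "2 * real n \<le> ln (real N)" using eN n by (simp add: ln_ge_iff)
qed

text \<open>Singleton cells with \<open>s\<close> about \<open>n\<close>/2: at least half of the
  remaining vertices succeed. As \<open>s\<close> \<ge> \<open>n\<close>/4, the product of 1/4, 1/2
  and 1/2 gives the constant 1/16.\<close>

lemma prob_lower_dense:
  fixes p :: real
  assumes n: "n \<ge> 4" and N: "real N \<ge> real n * exp (2 * real n)"
    and p: "0 < p" "p \<le> 1" and pN: "p \<ge> real N powr (- 2 / (5 * real n))"
  shows "measure_pmf.prob (gnp N p)
     {G. 1/16 * real n * real N \<le> ex_graph G (path_vertices (n + 1)) (path_edges (n + 1))}
     \<ge> 1 - exp (- real n / 10 ^ 4)"
proof -
  define s where "s = (n - 1) div 2"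
  have s: "real n / 4 \<le> real s" "2 * s + 1 \<le> n" "s > 0" using n by (auto simp: s_def)
  define L where "L = ln (real N)"
  have n0: "n > 0" using n by simp
  note nN = large_N(1)[OF n0 N] and L = large_N(2)[OF n0 N, folded L_def]
  have N0: "real N > 0" using nN n0 by simp
  have Nexp: "real N = exp L" using N0 by (simp add: L_def)
  have lnp: "- 2 * L / (5 * n) \<le> ln p"
  proof -
    have "ln (real N powr (- 2 / (5 * real n))) \<le> ln p" using pN p N0 by (intro ln_mono) auto
    then show ?thesis using N0 by (simp add: ln_powr L_def)
  qed
  have "1 \<le> real (N div (2 * (s * 1))) * (real 1 * p / (1 + real 1 * p)) ^ s"
  proof -
    \<comment> \<open>With \<open>s\<close> \<le> \<open>n\<close>/2 the lower bound on
      \<open>p\<close> costs \<open>N\<close>^(-1/5). The halvings cost at most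
      exp(\<open>n\<close>/2) \<le> \<open>N\<close>^(1/4), as 2\<open>n\<close> \<le>
      \<open>L\<close>; and 1/5 + 1/4 = 9/20.\<close>
    have "exp (- (9/20) * L) \<le> (p / 2) ^ s"
    proof -
      have "(p / 2) ^ s = exp (s * ln (p / 2))" using p by (simp add: exp_of_nat_mult)
      have "- 2 * L / (5 * n) - 1 \<le> ln (p / 2)"
        using lnp p ln_2_less_1 by (simp add: ln_div)
      then have "s * (- 2 * L / (5 * n) - 1) \<le> s * ln (p / 2)" by (intro mult_left_mono) auto
      moreover have "- (9/20) * L \<le> s * (- 2 * L / (5 * n) - 1)"
      proof -
        have "s * (2 * L / (5 * n) + 1) \<le> (n / 2) * (2 * L / (5 * n) + 1)"
          using s(2) L by (intro mult_right_mono) auto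
        also have "\<dots> = L / 5 + n / 2" using n by (simp add: field_simps)
        also have "\<dots> \<le> 9/20 * L" using L by simp
        finally show ?thesis by (simp add: algebra_simps)
      qed
      ultimately show ?thesis using \<open>(p / 2) ^ s = exp (s * ln (p / 2))\<close> by simp
    qed
    also have "\<dots> \<le> (real 1 * p / (1 + real 1 * p)) ^ s"
      using p by (intro power_mono) (auto simp: field_simps)
    finally have a: "exp (- (9/20) * L) \<le> (real 1 * p / (1 + real 1 * p)) ^ s" .
    have "2 * s \<le> N" using s(2) nN by linarith
    then have "real N / (2 * real (2 * s)) \<le> real (N div (2 * s))" using s(3) by (intro div_ge_half) auto
    moreover have "real N / (2 * real n) \<le> real N / (2 * real (2 * s))"
      using s by (intro divide_left_mono) auto
    ultimately have b: "real N / (2 * real n) \<le> real (N div (2 * (s * 1)))" by simp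
    \<comment> \<open>The power \<open>N\<close>^(11/20) that is left exceeds exp \<open>n\<close>,
      which is at least 2\<open>n\<close>.\<close>
    have "1 \<le> real N / (2 * real n) * exp (- (9/20) * L)"
    proof -
      have "2 * real n \<le> 1 + real n + (real n)\<^sup>2 / 2"
        using sum_squares_ge_zero[of "real n - 1" 0] by (simp add: power2_eq_square algebra_simps)
      also have "\<dots> \<le> exp (real n)" by (rule exp_lower_Taylor_quadratic) simp
      also have "\<dots> \<le> exp (11/20 * L)" using L by simp
      also have "\<dots> = real N * exp (- (9/20) * L)" unfolding Nexp by (simp flip: exp_add)
      finally show ?thesis using n by (simp add: field_simps)
    qed
    also have "\<dots> \<le> real (N div (2 * (s * 1))) * (real 1 * p / (1 + real 1 * p)) ^ s"
      using a b by (intro mult_mono) auto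
    finally show ?thesis .
  qed
  moreover have "1/2 + 1/100 \<le> 1 - exp (- 1 :: real)"
  proof -
    have "5/2 \<le> exp (1::real)" using exp_lower_Taylor_quadratic[of 1] by simp
    then have "exp (- 1 :: real) \<le> 2/5" by (simp add: exp_minus inverse_eq_divide field_simps)
    then show ?thesis by simp
  qed
  ultimately have "1 - exp (- real N / 10 ^ 4) \<le> measure_pmf.prob (gnp N p)
     {G. s * (1/2) * real N / 2 \<le> ex_graph G (path_vertices (n + 1)) (path_edges (n + 1))}"
    using p s N0 by (intro prob_ex_graph_path_ge_linear[where r = 1 and c = 1]) auto
  also have "\<dots> \<le> measure_pmf.prob (gnp N p)
     {G. 1/16 * real n * real N \<le> ex_graph G (path_vertices (n + 1)) (path_edges (n + 1))}"
  proof (intro measure_pmf.finite_measure_mono subsetI)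
    have "1/16 * real n * real N \<le> s * (1/2) * real N / 2"
      using mult_right_mono[OF s(1), of "real N / 4"] by simp
    then show "G \<in> {G. 1/16 * real n * real N \<le> ex_graph G (path_vertices (n + 1)) (path_edges (n + 1))}"
      if "G \<in> {G. s * (1/2) * real N / 2 \<le> ex_graph G (path_vertices (n + 1)) (path_edges (n + 1))}" for G
      using that by (simp only: mem_Collect_eq)
  qed simp
  finally have "1 - exp (- real N / 10 ^ 4) \<le> measure_pmf.prob (gnp N p)
     {G. 1/16 * real n * real N \<le> ex_graph G (path_vertices (n + 1)) (path_edges (n + 1))}" .
  moreover have "exp (- real N / 10 ^ 4) \<le> exp (- real n / 10 ^ 4)" using nN by simp
  ultimately show ?thesis by linarith
qed

section \<open>The sparse regime\<close>

text \<open>\<open>X\<close> is the scale of the result: both bounds are constant multiples of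
  \<open>X\<close> \<open>N\<close>. The threshold 20 absorbs the rounding in (\<open>n\<close> - 1)
  div 2 and in the choice of \<open>s\<close>.\<close>

locale sparse_regime =
  fixes n N :: nat and p :: real and L \<omega> X :: real
  assumes n: "n \<ge> 20" and N: "real N \<ge> real n * exp (2 * real n)"
    and p: "0 < p" "p \<le> 1" and pN: "1 / real N \<le> p" "p \<le> real N powr (- 2 / (5 * real n))"
  defines "L \<equiv> ln (real N)" and "\<omega> \<equiv> ln (real N) / (real n * p)" and "X \<equiv> ln (real N) / ln \<omega>"
begin

lemma n0: "n > 0" using n by simp

lemmas nN = large_N(1,3)[OF n0 N] and L = large_N(2)[OF n0 N, folded L_def]

lemma N0: "real N > 0" using nN n0 by simp

lemma Nexp: "real N = exp L" using N0 by (simp add: L_def)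

lemma L0: "L > 0" using L n0 by simp

lemma \<omega>0: "\<omega> > 0" using L0 p n0 by (simp add: \<omega>_def L_def[symmetric])

text \<open>Split \<open>\<omega>\<close> as (\<open>L\<close>/\<open>n\<close>) / \<open>p\<close>:
  the upper bound on \<open>p\<close> gives the first summand, and \<open>L\<close>/\<open>n\<close>
  \<ge> 2 with ln 2 \<ge> 2/3 the second. The first alone yields \<open>X\<close> \<le>
  5\<open>n\<close>/2.\<close>

lemma ln_\<omega>: "ln \<omega> \<ge> 2 * L / (5 * n) + 2/3"
proof -
  have "ln p \<le> ln (real N powr (- 2 / (5 * real n)))" using pN p N0 by (intro ln_mono) auto
  then have "ln p \<le> - 2 * L / (5 * n)" using N0 by (simp add: ln_powr L_def)
  moreover have "2 \<le> L / n" using L n0 by (simp add: field_simps)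
  then have "ln 2 \<le> ln (L / n)" by (intro ln_mono) auto
  moreover have "\<omega> = (L / n) / p" by (simp add: \<omega>_def L_def)
  then have "ln \<omega> = ln (L / n) - ln p" using L0 n0 p by (simp add: ln_div ln_mult)
  ultimately show ?thesis using ln2_ge_two_thirds by linarith
qed

lemma ln_\<omega>_ge_1: "ln \<omega> \<ge> 1"
proof -
  have "4/5 \<le> 2 * L / (5 * n)" using L n0 by (simp add: field_simps)
  then show ?thesis using ln_\<omega> by linarith
qed

lemma \<omega>_ge_2: "\<omega> \<ge> 2"
proof -
  have "exp 1 \<le> \<omega>" using ln_\<omega>_ge_1 \<omega>0 by (simp add: ln_ge_iff)
  then show ?thesis using exp_ge_add_one_self[of 1] by linarith
qed

lemma X_bounds: "X > 0" "X \<le> 5 * n / 2" "X * ln \<omega> = L"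
proof -
  show X: "X * ln \<omega> = L" using ln_\<omega>_ge_1 by (simp add: X_def L_def)
  show "X > 0" using ln_\<omega>_ge_1 L0 by (simp add: X_def L_def[symmetric])
  then have "X * (2 * L / (5 * n)) \<le> X * ln \<omega>" using ln_\<omega> by (intro mult_left_mono) auto
  then have "X * (2 * L / (5 * n)) \<le> 1 * L" using X by simp
  then show "X \<le> 5 * n / 2" using L0 n0 by (simp add: field_simps)
qed

lemma target_eq: "c * (\<omega> / ln \<omega>) * p * n * N = c * X * N"
  using p n0 by (simp add: \<omega>_def X_def)

lemma prob_upper:
  "measure_pmf.prob (gnp N p) {G. 8 * (\<omega> / ln \<omega>) * p * n * N < ex_graph G (path_vertices (n + 1)) (path_edges (n + 1))}
     \<le> exp (- real n)"
proof -
  define t where "t = nat \<lfloor>8 * X * N\<rfloor> + 1"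
  have "8 * X * N \<ge> 0" using X_bounds(1) by simp
  then have t: "8 * X * N \<le> t" unfolding t_def by linarith
  have t0: "0 < t" by (simp add: t_def)
  have XN: "0 < 8 * X * N" using X_bounds(1) N0 by simp
  have sub: "t \<le> k" if "8 * X * N < real k" for k :: nat
    using that \<open>8 * X * N \<ge> 0\<close> unfolding t_def by linarith
  have "measure_pmf.prob (gnp N p) {G. 8 * (\<omega> / ln \<omega>) * p * n * N < ex_graph G (path_vertices (n + 1)) (path_edges (n + 1))}
    \<le> measure_pmf.prob (gnp N p) {G. t \<le> ex_graph G (path_vertices (n + 1)) (path_edges (n + 1))}"
    using sub unfolding target_eq by (intro measure_pmf.finite_measure_mono) auto
  also have "\<dots> \<le> real (N + 1) ^ N * (real ((n * N) choose t) * p ^ t)"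
    using p n0 by (intro prob_ex_graph_path_gt) auto
  \<comment> \<open>There are at most \<open>N\<close>^(2\<open>N\<close>) forests, and each is bad
    with probability at most \<open>\<omega>\<close>^(-\<open>t\<close>/2) \<le>
    \<open>N\<close>^(-4\<open>N\<close>), because \<open>t\<close> \<ge> 8 \<open>X\<close>
    \<open>N\<close> and \<open>X\<close> ln \<open>\<omega>\<close> = \<open>L\<close>.\<close>
  also have "\<dots> \<le> exp (2 * N * L) * exp (- 4 * N * L)"
  proof (rule mult_mono)
    have "real (N + 1) \<le> real N * real N"
    proof -
      have "2 * real N \<le> real N * real N" using nN n by (intro mult_right_mono) auto
      moreover have "1 \<le> real N" using nN n by linarith
      ultimately show ?thesis by (simp only: of_nat_add of_nat_1)
    qed
    also have "\<dots> = exp (2 * L)" by (simp add: Nexp flip: exp_add)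
    finally have "real (N + 1) ^ N \<le> exp (2 * L) ^ N" by (rule power_mono) simp
    also have "\<dots> = exp (2 * N * L)" by (simp add: mult_ac flip: exp_of_nat_mult)
    finally show "real (N + 1) ^ N \<le> exp (2 * N * L)" .
    have "real ((n * N) choose t) * p ^ t \<le> (exp 1 * real (n * N) / t) ^ t * p ^ t"
      using p binomial_le_exp_power[OF t0, of "n * N"] by (intro mult_right_mono) auto
    also have "\<dots> = (exp 1 * real (n * N) * p / t) ^ t" by (simp flip: power_mult_distrib)
    also have "\<dots> \<le> exp (- ln \<omega> / 2) ^ t"
    proof (rule power_mono)
      have "exp 1 * real (n * N) * p / t \<le> exp 1 * real (n * N) * p / (8 * X * N)"
        using t XN p by (intro divide_left_mono) auto
      also have "\<dots> = exp 1 / 8 * (ln \<omega> / \<omega>)"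
        using N0 L0 n0 p ln_\<omega>_ge_1 by (simp add: X_def \<omega>_def field_simps)
      \<comment> \<open>With \<open>y\<close> the square root of \<open>\<omega>\<close>, ln
        \<open>\<omega>\<close> \<le> 2\<open>y\<close> and e \<le> 3 bound the factor e/8 ln
        \<open>\<omega>\<close> by \<open>y\<close>.\<close>
      also have "\<dots> \<le> exp (- ln \<omega> / 2)"
      proof -
        define y where "y = exp (ln \<omega> / 2)"
        have y: "y > 0" "\<omega> = y * y" using \<omega>0 by (simp_all add: y_def flip: exp_add)
        have "ln \<omega> / 2 \<le> y" using exp_ge_add_one_self[of "ln \<omega> / 2"] unfolding y_def by linarith
        then have "exp 1 / 8 * ln \<omega> \<le> 3 / 8 * (2 * y)"
          using exp_le ln_\<omega>_ge_1 by (intro mult_mono) auto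
        also have "\<dots> \<le> y" using y by simp
        finally have "exp 1 / 8 * ln \<omega> / \<omega> \<le> y / \<omega>"
            using \<omega>0 by (intro divide_right_mono) auto
        then have "exp 1 / 8 * (ln \<omega> / \<omega>) \<le> y / \<omega>" by simp
        also have "y / \<omega> = 1 / y" using y(1) by (simp only: y(2)) simp
        also have "\<dots> = exp (- ln \<omega> / 2)" by (simp add: y_def exp_minus inverse_eq_divide)
        finally show ?thesis .
      qed
      finally show "exp 1 * real (n * N) * p / t \<le> exp (- ln \<omega> / 2)" .
    qed (use p in simp)
    also have "\<dots> = exp (- (t * ln \<omega> / 2))" by (simp flip: exp_of_nat_mult)
    also have "\<dots> \<le> exp (- 4 * N * L)"
    proof -
      have "8 * X * N * ln \<omega> \<le> t * ln \<omega>" using t ln_\<omega>_ge_1 by (intro mult_right_mono) auto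
      moreover have "8 * X * N * ln \<omega> = 8 * N * L" using X_bounds(3) by (simp add: mult_ac)
      ultimately show ?thesis by simp
    qed
    finally show "real ((n * N) choose t) * p ^ t \<le> exp (- 4 * N * L)" .
  qed (use p in auto)
  also have "\<dots> = exp (- (2 * N * L))" by (simp flip: exp_add)
  also have "\<dots> \<le> exp (- real n)"
  proof -
    have "1 * real n \<le> (2 * N) * L" using L N0 nN n by (intro mult_mono) auto
    then show ?thesis by simp
  qed
  finally show ?thesis .
qed

text \<open>For small \<open>X\<close> a single large cell suffices, since \<open>s\<close> = 1
  already meets the bound; otherwise \<open>s\<close> is \<open>X\<close> / 7.5 rounded up and
  \<open>r\<close> fills the budget of \<open>k\<close> vertices per block. Either way a vertex hits
  at least 1/4 block on average.\<close>

lemma block_parameters: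
  obtains s r where "0 < r" "0 < s" "2 * (s * r) + 1 \<le> n" "X / 7.5 \<le> real s"
    "1/4 \<le> real (N div (2 * (s * r))) * (r * p / (1 + r * p)) ^ s"
proof -
  define k where "k = (n - 1) div 2"
  have k: "2 * k + 1 \<le> n" "2 * real n / 5 \<le> real k" "real n / 2 - 1 \<le> real k" "k > 0"
      using n by (auto simp: k_def)
  show ?thesis
  proof (cases "X \<le> 7.5")
    case True
    have "1/4 \<le> real (N div (2 * k)) * (k * p / (1 + k * p))"
    proof -
      have "N < 2 * k * (N div (2 * k)) + 2 * k" using dividend_less_times_div[of "2 * k" N] k by simp
      then have "real N < real (2 * k * (N div (2 * k)) + 2 * k)" by (simp only: of_nat_less_iff)
      then have m: "real N - 2 * k \<le> 2 * real k * real (N div (2 * k))" by simp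
      \<comment> \<open>This is where \<open>p\<close> \<ge> 1/\<open>N\<close> enters. The target
        1/4 then amounts to 5\<open>k\<close> \<le> \<open>N\<close>.\<close>
      have "k / (k + N) \<le> k * p / (1 + k * p)"
      proof -
        have "1 \<le> N * p" using pN(1) N0 by (simp add: field_simps)
        then have "real k * 1 \<le> real k * (N * p)" by (intro mult_left_mono) auto
        then show ?thesis using k p by (simp add: field_simps add_pos_nonneg)
      qed
      have "1/4 \<le> (real N - 2 * k) / 2 / (k + N)"
      proof -
        have "5 * real k \<le> real N" using k(1) nN by linarith
        then show ?thesis using k by (simp add: field_simps)
      qed
      also have "\<dots> \<le> (real k * real (N div (2 * k))) / (k + N)"
        using m by (intro divide_right_mono) auto
      also have "\<dots> = real (N div (2 * k)) * (k / (k + N))" by simp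
      also have "\<dots> \<le> real (N div (2 * k)) * (k * p / (1 + k * p))"
        using \<open>k / (k + N) \<le> k * p / (1 + k * p)\<close> by (intro mult_left_mono) auto
      finally show ?thesis .
    qed
    then show ?thesis using True k by (intro that[of k 1]) auto
  next
    case False
    define s where "s = nat \<lceil>X / 7.5\<rceil>"
    have s: "X / 7.5 \<le> s" "s < X / 7.5 + 1"
      using ceiling_correct[of "X / 7.5"] X_bounds(1) by (simp_all add: s_def real_nat_ceiling_ge)
    then have s0: "0 < s" using False by (cases s) auto
    \<comment> \<open>As \<open>X\<close> / 7.5 > 1, rounding up at most doubles it.\<close>
    have s2: "s \<le> X / 3.75" using s(2) False by simp
    have sk: "s \<le> k"
    proof -
      have "s < n / 3 + 1" using s(2) X_bounds(2) by simp
      then have "real s \<le> real k" using k(3) n by linarith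
      then show ?thesis by simp
    qed
    define r where "r = k div s"
    have r: "real k / (2 * real s) \<le> real r" unfolding r_def using s0 sk by (rule div_ge_half)
    have r0: "0 < r" using s0 sk by (simp add: r_def div_greater_zero_iff)
    have srk: "s * r \<le> k" by (simp add: r_def)
    \<comment> \<open>From \<open>r\<close> \<ge> \<open>n\<close> / (5\<open>s\<close>) and
      \<open>s\<close> \<le> \<open>X\<close> / 3.75 \<le> \<open>L\<close> / 3.75. With
      \<open>\<omega>\<close> \<ge> 2 it makes the hitting probability of a cell at least
      \<open>\<omega>\<close>^(-2).\<close>
    have "1 / (r * p) \<le> 4/3 * \<omega>"
    proof -
      have "real n / (5 * s) \<le> real k / (2 * real s)"
        using k(2) s0 by (simp add: field_simps)
      then have rn: "real n / (5 * s) \<le> r" using r by linarith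
      then have "1 / (r * p) \<le> 1 / (real n / (5 * s) * p)"
        using s0 n0 p r0 by (intro divide_left_mono mult_right_mono) auto
      also have "\<dots> = 5 * s / (n * p)" using s0 n0 p by (simp add: field_simps)
      also have "\<dots> \<le> 5 * (X / 3.75) / (n * p)" using s2 n0 p by (intro divide_right_mono) auto
      also have "\<dots> \<le> 5 * (L / 3.75) / (n * p)"
      proof -
        have "X * 1 \<le> X * ln \<omega>" using ln_\<omega>_ge_1 X_bounds(1) by (intro mult_left_mono) auto
        then show ?thesis using X_bounds(3) n0 p by (intro divide_right_mono) auto
      qed
      also have "\<dots> = 4/3 * \<omega>" by (simp add: \<omega>_def L_def)
      finally show ?thesis .
    qed
    have "1 + 4/3 * \<omega> \<le> \<omega> * \<omega>"
      using mult_right_mono[OF \<omega>_ge_2, of \<omega>] \<omega>_ge_2 by linarith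
    also have "\<omega> * \<omega> = exp (2 * ln \<omega>)"
      using \<omega>0 exp_add[of "ln \<omega>" "ln \<omega>"] by simp
    finally have "1 + 1 / (r * p) \<le> exp (2 * ln \<omega>)"
      using \<open>1 / (r * p) \<le> 4/3 * \<omega>\<close> by linarith
    moreover have "0 < 1 + 1 / (r * p)" using r0 p by (intro add_pos_pos) auto
    ultimately have "1 / exp (2 * ln \<omega>) \<le> 1 / (1 + 1 / (r * p))" by (intro divide_left_mono) auto
    then have "exp (- (2 * ln \<omega>)) \<le> 1 / (1 + 1 / (r * p))"
      by (simp only: exp_minus inverse_eq_divide)
    also have "\<dots> = r * p / (1 + r * p)" using r0 p by (simp add: field_simps)
    finally have "exp (- (2 * ln \<omega>)) ^ s \<le> (r * p / (1 + r * p)) ^ s" by (rule power_mono) simp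
    \<comment> \<open>All \<open>s\<close> cells together cost at most \<open>\<omega>\<close>^(2
      \<open>X\<close> / 3.75) = \<open>N\<close>^(8/15); the remaining \<open>N\<close>^(7/15) is
      at least \<open>n\<close>/2 and pays for the block count \<open>N\<close> /
      (2\<open>n\<close>).\<close>
    moreover have "exp (- (8/15 * L)) \<le> exp (- (2 * ln \<omega>)) ^ s"
    proof -
      have "s * (2 * ln \<omega>) \<le> X / 3.75 * (2 * ln \<omega>)"
          using s2 ln_\<omega>_ge_1 by (intro mult_right_mono) auto
      also have "\<dots> = 8/15 * L" using X_bounds(3) by simp
      finally show ?thesis by (simp flip: exp_of_nat_mult)
    qed
    ultimately have pw: "exp (- (8/15 * L)) \<le> (r * p / (1 + r * p)) ^ s" by linarith
    have "2 * (s * r) \<le> n" using srk k(1) by linarith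
    then have "2 * (s * r) \<le> N" using nN by linarith
    then have "real N / (2 * real (2 * (s * r))) \<le> real (N div (2 * (s * r)))"
      using s0 r0 by (intro div_ge_half) auto
    moreover have "real N / (2 * real n) \<le> real N / (2 * real (2 * (s * r)))"
      using \<open>2 * (s * r) \<le> n\<close> s0 r0 n0
          by (intro divide_left_mono mult_left_mono) (auto simp flip: of_nat_mult)
    ultimately have m: "real N / (2 * real n) \<le> real (N div (2 * (s * r)))" by linarith
    have "1/4 \<le> real N / (2 * real n) * exp (- (8/15 * L))"
    proof -
      have "real n / 2 \<le> 1 + 7/15 * L" using L by simp
      also have "\<dots> \<le> exp (7/15 * L)" by (rule exp_ge_add_one_self)
      also have "\<dots> = real N * exp (- (8/15 * L))" unfolding Nexp by (simp flip: exp_add)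
      finally show ?thesis using n0 by (simp add: field_simps)
    qed
    also have "\<dots> \<le> real (N div (2 * (s * r))) * (r * p / (1 + r * p)) ^ s"
      using m pw by (intro mult_mono) auto
    finally show ?thesis using s s0 r0 srk k(1) by (intro that[of r s]) auto
  qed
qed

text \<open>A fraction 1/5 of at least \<open>N\<close>/2 vertices succeeds, because 1 - exp(-1/4)
  \<ge> 21/100; each gives \<open>s\<close> \<ge> \<open>X\<close> / 7.5 edges, and 7.5 times 10 is
  75.\<close>

lemma prob_lower:
  "measure_pmf.prob (gnp N p)
     {G. 1/75 * (\<omega> / ln \<omega>) * p * n * N \<le> ex_graph G (path_vertices (n + 1)) (path_edges (n + 1))}
     \<ge> 1 - exp (- real n / 10 ^ 4)"
proof -
  obtain s r where rs: "0 < r" "0 < s" "2 * (s * r) + 1 \<le> n" "X / 7.5 \<le> real s"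
    "1/4 \<le> real (N div (2 * (s * r))) * (r * p / (1 + r * p)) ^ s"
    by (rule block_parameters)
  have "1/5 + 1/100 \<le> 1 - exp (- (1/4) :: real)"
  proof -
    have "41/32 \<le> exp (1/4::real)" using exp_lower_Taylor_quadratic[of "1/4"] by (simp add: power2_eq_square)
    then have "exp (- (1/4) :: real) \<le> 32/41" by (simp add: exp_minus inverse_eq_divide field_simps)
    then show ?thesis by simp
  qed
  with rs have "1 - exp (- real N / 10 ^ 4) \<le> measure_pmf.prob (gnp N p)
     {G. s * (1/5) * real N / 2 \<le> ex_graph G (path_vertices (n + 1)) (path_edges (n + 1))}"
    using p N0 by (intro prob_ex_graph_path_ge_linear[where r = r and c = "1/4"]) auto
  also have "\<dots> \<le> measure_pmf.prob (gnp N p)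
     {G. 1/75 * (\<omega> / ln \<omega>) * p * n * N \<le> ex_graph G (path_vertices (n + 1)) (path_edges (n + 1))}"
  proof (intro measure_pmf.finite_measure_mono subsetI)
    have "1/75 * X * N \<le> s * (1/5) * real N / 2"
      using mult_right_mono[OF rs(4), of "real N / 10"] by simp
    then show "G \<in> {G. 1/75 * (\<omega> / ln \<omega>) * p * n * N \<le> ex_graph G (path_vertices (n + 1)) (path_edges (n + 1))}"
      if "G \<in> {G. s * (1/5) * real N / 2 \<le> ex_graph G (path_vertices (n + 1)) (path_edges (n + 1))}" for G
      using that unfolding target_eq by (simp only: mem_Collect_eq)
  qed simp
  finally have "1 - exp (- real N / 10 ^ 4) \<le> measure_pmf.prob (gnp N p)
     {G. 1/75 * (\<omega> / ln \<omega>) * p * n * N \<le> ex_graph G (path_vertices (n + 1)) (path_edges (n + 1))}" .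
  moreover have "exp (- real N / 10 ^ 4) \<le> exp (- real n / 10 ^ 4)" using nN by simp
  ultimately show ?thesis by linarith
qed

lemma prob_both:
  "measure_pmf.prob (gnp N p)
     {G. 1/75 * (\<omega> / ln \<omega>) * p * real n * real N \<le> real (ex_graph G (path_vertices (n + 1)) (path_edges (n + 1)))
       \<and> real (ex_graph G (path_vertices (n + 1)) (path_edges (n + 1))) \<le> 8 * (\<omega> / ln \<omega>) * p * real n * real N}
     \<ge> 1 - exp (- real n / 10 ^ 4) - exp (- real n)" (is "measure_pmf.prob _ {G. ?lo G \<and> ?up G} \<ge> _")
proof -
  have "measure_pmf.prob (gnp N p) {G. ?lo G} \<le> measure_pmf.prob (gnp N p) ({G. ?lo G \<and> ?up G} \<union> {G. \<not> ?up G})"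
    by (intro measure_pmf.finite_measure_mono) auto
  also have "\<dots> \<le> measure_pmf.prob (gnp N p) {G. ?lo G \<and> ?up G} + measure_pmf.prob (gnp N p) {G. \<not> ?up G}"
    by (rule measure_Un_le) auto
  finally show ?thesis using prob_lower prob_upper by (simp add: not_le)
qed

end

section \<open>Both regimes in the limit\<close>

theorem theorem1p5:
  fixes N :: "nat \<Rightarrow> nat" and p :: "nat \<Rightarrow> real"
  assumes hN: "\<forall>\<^sub>F n in sequentially. real (N n) \<ge> real n * exp (2 * real n)"
    and hp: "\<forall>\<^sub>F n in sequentially. 0 < p n \<and> p n \<le> 1"
  shows
   "((\<forall>\<^sub>F n in sequentially. p n \<ge> real (N n) powr (- 2 / (5 * real n))) \<longrightarrow>
      ((\<lambda>n. measure_pmf.prob (gnp (N n) (p n))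
          {G. 1/16 * real n * real (N n)
                \<le> real (ex_graph G (path_vertices (n+1)) (path_edges (n+1)))
            \<and> real (ex_graph G (path_vertices (n+1)) (path_edges (n+1)))
                \<le> 1/2 * real n * real (N n)}) \<longlonglongrightarrow> 1))
    \<and>
    ((\<forall>\<^sub>F n in sequentially. 1 / real (N n) \<le> p n \<and> p n \<le> real (N n) powr (- 2 / (5 * real n))) \<longrightarrow>
      ((\<lambda>n. let \<omega> = ln (real (N n)) / (real n * p n) in
          measure_pmf.prob (gnp (N n) (p n))
          {G. 1/75 * (\<omega> / ln \<omega>) * p n * real n * real (N n)
                \<le> real (ex_graph G (path_vertices (n+1)) (path_edges (n+1)))
            \<and> real (ex_graph G (path_vertices (n+1)) (path_edges (n+1)))
                \<le> 8 * (\<omega> / ln \<omega>) * p n * real n * real (N n)}) \<longlonglongrightarrow> 1))"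
proof (intro conjI impI)
  \<comment> \<open>One minorant serves both regimes. In the dense one the upper bound holds for
    every graph in the support, so only the first error term really occurs there.\<close>
  have lim: "(\<lambda>n. 1 - exp (- real n / 10 ^ 4) - exp (- real n)) \<longlonglongrightarrow> 1" by real_asymp
  have squeeze: "f \<longlonglongrightarrow> 1"
    if "\<forall>\<^sub>F n in sequentially. 1 - exp (- real n / 10 ^ 4) - exp (- real n) \<le> f n" "\<And>n. f n \<le> 1" for f :: "nat \<Rightarrow> real"
    by (rule tendsto_sandwich[OF that(1) _ lim tendsto_const]) (use that(2) in auto)
  {
    assume h: "\<forall>\<^sub>F n in sequentially. p n \<ge> real (N n) powr (- 2 / (5 * real n))"
    show "(\<lambda>n. measure_pmf.prob (gnp (N n) (p n))
          {G. 1/16 * real n * real (N n)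
                \<le> real (ex_graph G (path_vertices (n+1)) (path_edges (n+1)))
            \<and> real (ex_graph G (path_vertices (n+1)) (path_edges (n+1)))
                \<le> 1/2 * real n * real (N n)}) \<longlonglongrightarrow> 1"
    proof (rule squeeze)
      show "\<forall>\<^sub>F n in sequentially. 1 - exp (- real n / 10 ^ 4) - exp (- real n)
        \<le> measure_pmf.prob (gnp (N n) (p n))
          {G. 1/16 * real n * real (N n)
                \<le> real (ex_graph G (path_vertices (n+1)) (path_edges (n+1)))
            \<and> real (ex_graph G (path_vertices (n+1)) (path_edges (n+1)))
                \<le> 1/2 * real n * real (N n)}"
        using hN hp h eventually_ge_at_top[of 4]
      proof eventually_elim
        case (elim n)
        have "measure_pmf.prob (gnp (N n) (p n))
            {G. 1/16 * real n * real (N n) \<le> real (ex_graph G (path_vertices (n+1)) (path_edges (n+1)))}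
          \<le> measure_pmf.prob (gnp (N n) (p n))
            {G. 1/16 * real n * real (N n)
                  \<le> real (ex_graph G (path_vertices (n+1)) (path_edges (n+1)))
              \<and> real (ex_graph G (path_vertices (n+1)) (path_edges (n+1)))
                  \<le> 1/2 * real n * real (N n)}"
        proof (rule measure_pmf.finite_measure_mono_AE)
          show "AE G in gnp (N n) (p n). G \<in> {G. 1/16 * real n * real (N n) \<le> real (ex_graph G (path_vertices (n+1)) (path_edges (n+1)))}
            \<longrightarrow> G \<in> {G. 1/16 * real n * real (N n)
                  \<le> real (ex_graph G (path_vertices (n+1)) (path_edges (n+1)))
              \<and> real (ex_graph G (path_vertices (n+1)) (path_edges (n+1)))
                  \<le> 1/2 * real n * real (N n)}"
            using ex_graph_path_le_Erdos_Gallai[of _ "N n" "p n" n] elim(4) by (intro AE_pmfI) auto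
        qed simp
        moreover have "1 - exp (- real n / 10 ^ 4) \<le> measure_pmf.prob (gnp (N n) (p n))
            {G. 1/16 * real n * real (N n) \<le> real (ex_graph G (path_vertices (n+1)) (path_edges (n+1)))}"
          using elim by (intro prob_lower_dense) auto
        moreover have "exp (- real n) > 0" by simp
        ultimately show ?case by linarith
      qed
    qed simp
  next
    assume h: "\<forall>\<^sub>F n in sequentially. 1 / real (N n) \<le> p n \<and> p n \<le> real (N n) powr (- 2 / (5 * real n))"
    show "(\<lambda>n. let \<omega> = ln (real (N n)) / (real n * p n) in
          measure_pmf.prob (gnp (N n) (p n))
          {G. 1/75 * (\<omega> / ln \<omega>) * p n * real n * real (N n)
                \<le> real (ex_graph G (path_vertices (n+1)) (path_edges (n+1)))
            \<and> real (ex_graph G (path_vertices (n+1)) (path_edges (n+1)))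
                \<le> 8 * (\<omega> / ln \<omega>) * p n * real n * real (N n)}) \<longlonglongrightarrow> 1"
      unfolding Let_def
    proof (rule squeeze)
      show "\<forall>\<^sub>F n in sequentially. 1 - exp (- real n / 10 ^ 4) - exp (- real n)
        \<le> measure_pmf.prob (gnp (N n) (p n))
          {G. 1/75 * (ln (real (N n)) / (real n * p n) / ln (ln (real (N n)) / (real n * p n))) * p n * real n * real (N n)
                \<le> real (ex_graph G (path_vertices (n+1)) (path_edges (n+1)))
            \<and> real (ex_graph G (path_vertices (n+1)) (path_edges (n+1)))
                \<le> 8 * (ln (real (N n)) / (real n * p n) / ln (ln (real (N n)) / (real n * p n))) * p n * real n * real (N n)}"
        using hN hp h eventually_ge_at_top[of 20]
      proof eventually_elim
        case (elim n)
        then interpret sparse_regime n "N n" "p n" "ln (real (N n))" "ln (real (N n)) / (real n * p n)"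
            "ln (real (N n)) / ln (ln (real (N n)) / (real n * p n))"
          by unfold_locales auto
        show ?case by (rule prob_both)
      qed
    qed simp
  }
qed

end
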